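(* Let $\Omega\subset\mathbb C$ be a connected open set, and let $$T=\begin{pmatrix}T_0 & S\\ 0 & T_1\end{pmatrix}\ \text{ on } \mathcal H_0\oplus\mathcal H_1,\qquad \tilde T=\begin{pmatrix}\tilde T_0 & \tilde S\\ 0 & \tilde T_1\end{pmatrix}\ \text{ on } \tilde{\mathcal H}_0\oplus\tilde{\mathcal H}_1$$ be two operators in $\mathcal FB_2(\Omega)$, written in decompositions as in the definition of $\mathcal FB_2(\Omega)$ (so $T_0,T_1,\tilde T_0,\tilde T_1\in B_1(\Omega)$, $S\neq 0$, $\tilde S\neq 0$, $T_0S=ST_1$, $\tilde T_0\tilde S=\tilde S\tilde T_1$). Let $t_1$ and $\tilde t_1$ be non-zero (i.e. nowhere vanishing) holomorphic sections over $\Omega$ of the holomorphic Hermitian line bundles $E_{T_1}$ and $E_{\tilde T_1}$ respectively. Then $T$ and $\tilde T$ are unitarily equivalent if and only if $$\mathcal K_{T_0}=\mathcal K_{\tilde T_0}\quad\text{and}\quad \frac{\|S(t_1)\|^2}{\|t_1\|^2}=\frac{\|\tilde S(\tilde t_1)\|^2}{\|\tilde t_1\|^2}\quad\text{on } \Omega .$$ The same equivalence holds with the condition $\mathcal K_{T_0}=\mathcal K_{\tilde T_0}$ replaced by $\mathcal K_{T_1}=\mathcal K_{\tilde T_1}$.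
   Context: Hilbert spaces are complex and separable. For a connected open set $\Omega\subset\mathbb C$ and $n\ge 1$, the Cowen-Douglas class $B_n(\Omega)$ consists of the bounded linear operators $T$ on a Hilbert space $\mathcal H$ such that for every $w\in\Omega$: $\dim\ker(T-w)=n$, $\operatorname{ran}(T-w)=\mathcal H$, and such that the closed linear span of $\bigcup_{w\in\Omega}\ker(T-w)$ is $\mathcal H$. For $T\in B_n(\Omega)$, $E_T$ denotes the rank $n$ holomorphic Hermitian vector bundle over $\Omega$ whose fibre at $w$ is $\ker(T-w)\subseteq\mathcal H$ (with the inner product of $\mathcal H$); its holomorphic sections are the holomorphic maps $s:\Omega\to\mathcal H$ with $s(w)\in\ker(T-w)$. $\mathcal FB_2(\Omega)$ is the set of operators $T\in B_2(\Omega)$ which admit, with respect to some orthogonal decomposition $\mathcal H=\mathcal H_0\oplus\mathcal H_1$, a decomposition $T=\begin{pmatrix}T_0&S\\0&T_1\end{pmatrix}$ with $T_0,T_1\in B_1(\Omega)$ and $S:\mathcal H_1\to\mathcal H_0$ a non-zero bounded operator satisfying $T_0S=ST_1$. For $A\in B_1(\Omega)$, the curvature is $\mathcal K_A(z)=-\frac{\partial^2}{\partial z\,\partial\bar z}\log\|\gamma(z)\|^2$, where $\gamma$ is any nowhere vanishing (local) holomorphic section of $E_A$; it does not depend on the choice of $\gamma$. The expression $\|S(t_1)\|^2/\|t_1\|^2$ denotes the function $w\mapsto\|S(t_1(w))\|^2/\|t_1(w)\|^2$. *)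

theory Defs
  imports "HOL-Analysis.Analysis"
begin

section \<open>Complex separable Hilbert spaces\<close>

class complex_vector = real_vector +
  fixes scaleC :: "complex \<Rightarrow> 'a \<Rightarrow> 'a"  (infixr "*\<^sub>C" 75)
  assumes scaleC_add_right: "a *\<^sub>C (x + y) = a *\<^sub>C x + a *\<^sub>C y"
    and scaleC_add_left: "(a + b) *\<^sub>C x = a *\<^sub>C x + b *\<^sub>C x"
    and scaleC_scaleC: "a *\<^sub>C b *\<^sub>C x = (a * b) *\<^sub>C x"
    and scaleC_one: "1 *\<^sub>C x = x"
    and scaleR_scaleC: "r *\<^sub>R x = complex_of_real r *\<^sub>C x"

global_interpretation complex_vector:
  vector_space "scaleC :: complex \<Rightarrow> 'a \<Rightarrow> 'a :: complex_vector"
  defines cdim = "complex_vector.dim :: 'a set \<Rightarrow> nat"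
    and cspan = "complex_vector.span :: 'a set \<Rightarrow> 'a set"
  by unfold_locales (simp_all add: scaleC_add_right scaleC_add_left scaleC_scaleC scaleC_one)

text \<open>The complex inner product is linear in its first argument.  Its real part is the real inner
  product of the type, so norm and topology are the ones induced by \<open>cinner\<close>.  Positive
  definiteness is inherited from the class of real inner product spaces.\<close>

class complex_inner = complex_vector + real_inner +
  fixes cinner :: "'a \<Rightarrow> 'a \<Rightarrow> complex"
  assumes cinner_commute: "cinner x y = cnj (cinner y x)"
    and cinner_add_left: "cinner (x + y) z = cinner x z + cinner y z"
    and cinner_scaleC_left: "cinner (a *\<^sub>C x) y = a * cinner x y"
    and inner_eq_Re_cinner: "inner x y = Re (cinner x y)"

class separable_chilbert = complex_inner + complete_space +
  assumes separable: "\<exists>D. countable D \<and> (\<forall>x. \<forall>e>0. \<exists>d\<in>D. dist d x < e)"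

lemma countable_dense:
  "\<exists>D :: 'a::separable_chilbert set. countable D \<and> closure D = UNIV"
  using separable[where 'a = 'a] by (auto simp: closure_approachable set_eq_iff)

text \<open>The orthogonal direct sum of two Hilbert spaces is their product type, which carries the
  real inner product \<open>inner (x, y) (x', y') = inner x x' + inner y y'\<close>.\<close>

instantiation prod :: (complex_vector, complex_vector) complex_vector
begin

definition scaleC_prod_def: "a *\<^sub>C p = (a *\<^sub>C fst p, a *\<^sub>C snd p)"

instance
  by standard
    (simp_all add: scaleC_prod_def scaleC_add_right scaleC_add_left scaleC_scaleC scaleC_one
      scaleR_prod_def scaleR_scaleC prod_eq_iff)

end

instantiation prod :: (complex_inner, complex_inner) complex_inner
begin

definition cinner_prod_def: "cinner p q = cinner (fst p) (fst q) + cinner (snd p) (snd q)"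

instance
proof
  fix p q r :: "'a \<times> 'b" and a :: complex
  show "cinner p q = cnj (cinner q p)"
    unfolding cinner_prod_def complex_cnj_add by (intro arg_cong2[where f = "(+)"] cinner_commute)
  show "cinner (p + q) r = cinner p r + cinner q r"
    by (simp add: cinner_prod_def cinner_add_left)
  show "cinner (a *\<^sub>C p) q = a * cinner p q"
    by (simp add: cinner_prod_def scaleC_prod_def cinner_scaleC_left distrib_left)
  show "inner p q = Re (cinner p q)"
    by (simp add: cinner_prod_def inner_prod_def inner_eq_Re_cinner)
qed

end

instance prod :: (separable_chilbert, separable_chilbert) separable_chilbert
proof
  obtain D :: "'a set" and E :: "'b set"
    where "countable D" "closure D = UNIV" "countable E" "closure E = UNIV"
    using countable_dense[where 'a = 'a] countable_dense[where 'a = 'b] by blast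
  then have "countable (D \<times> E)" "closure (D \<times> E) = UNIV"
    by (simp_all add: closure_Times)
  then show "\<exists>D :: ('a \<times> 'b) set. countable D \<and> (\<forall>x. \<forall>e>0. \<exists>d\<in>D. dist d x < e)"
    by (metis UNIV_I closure_approachable)
qed

section \<open>Operators\<close>

definition bounded_clinear :: "('a::complex_inner \<Rightarrow> 'b::complex_inner) \<Rightarrow> bool" where
  "bounded_clinear T \<longleftrightarrow> bounded_linear T \<and> (\<forall>c x. T (c *\<^sub>C x) = c *\<^sub>C T x)"

definition unitary :: "('a::complex_inner \<Rightarrow> 'b::complex_inner) \<Rightarrow> bool" where
  "unitary U \<longleftrightarrow>
     bounded_clinear U \<and> surj U \<and> (\<forall>x y. cinner (U x) (U y) = cinner x y)"

definition unitarily_equivalent ::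
  "('a::complex_inner \<Rightarrow> 'a) \<Rightarrow> ('b::complex_inner \<Rightarrow> 'b) \<Rightarrow> bool" where
  "unitarily_equivalent T T' \<longleftrightarrow> (\<exists>U. unitary U \<and> U \<circ> T = T' \<circ> U)"

definition eigenspace :: "('a::complex_inner \<Rightarrow> 'a) \<Rightarrow> complex \<Rightarrow> 'a set" where
  "eigenspace T w = {x. T x - w *\<^sub>C x = 0}"

text \<open>The class $B_n(\Omega)$.  Since \<open>n \<ge> 1\<close>, the condition \<open>cdim _ = n\<close> cannot hold through the
  convention that infinite-dimensional spaces have \<open>cdim\<close> 0.\<close>

definition cowen_douglas ::
  "nat \<Rightarrow> complex set \<Rightarrow> ('a::separable_chilbert \<Rightarrow> 'a) \<Rightarrow> bool" where
  "cowen_douglas n \<Omega> T \<longleftrightarrow>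
     n \<ge> 1 \<and> bounded_clinear T \<and>
     (\<forall>w\<in>\<Omega>. cdim (eigenspace T w) = n \<and> range (\<lambda>x. T x - w *\<^sub>C x) = UNIV) \<and>
     closure (cspan (\<Union>w\<in>\<Omega>. eigenspace T w)) = UNIV"

text \<open>The operator with matrix $(T_0, S; 0, T_1)$ on the orthogonal direct sum.\<close>

definition upper_block ::
  "('a \<Rightarrow> 'a::plus) \<Rightarrow> ('b \<Rightarrow> 'a) \<Rightarrow> ('b \<Rightarrow> 'b) \<Rightarrow> 'a \<times> 'b \<Rightarrow> 'a \<times> 'b" where
  "upper_block T\<^sub>0 S T\<^sub>1 = (\<lambda>(x, y). (T\<^sub>0 x + S y, T\<^sub>1 y))"

text \<open>\<open>T\<close> belongs to $\mathcal{F}B_2(\Omega)$, and \<open>T\<^sub>0, S, T\<^sub>1\<close> are the entries of a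
  decomposition witnessing this.\<close>

definition FB2_decomposition ::
  "complex set \<Rightarrow> ('a::separable_chilbert \<times> 'b::separable_chilbert \<Rightarrow> 'a \<times> 'b) \<Rightarrow>
   ('a \<Rightarrow> 'a) \<Rightarrow> ('b \<Rightarrow> 'a) \<Rightarrow> ('b \<Rightarrow> 'b) \<Rightarrow> bool" where
  "FB2_decomposition \<Omega> T T\<^sub>0 S T\<^sub>1 \<longleftrightarrow>
     cowen_douglas 2 \<Omega> T \<and> T = upper_block T\<^sub>0 S T\<^sub>1 \<and>
     cowen_douglas 1 \<Omega> T\<^sub>0 \<and> cowen_douglas 1 \<Omega> T\<^sub>1 \<and>
     bounded_clinear S \<and> S \<noteq> (\<lambda>_. 0) \<and> T\<^sub>0 \<circ> S = S \<circ> T\<^sub>1"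

section \<open>Holomorphic sections and curvature\<close>

text \<open>The library's \<open>holomorphic_on\<close> covers complex-valued maps only.\<close>

definition vholomorphic_on :: "(complex \<Rightarrow> 'a::complex_inner) \<Rightarrow> complex set \<Rightarrow> bool" where
  "vholomorphic_on f U \<longleftrightarrow>
     (\<forall>z\<in>U. \<exists>v. (f has_derivative (\<lambda>h. h *\<^sub>C v)) (at z within U))"

definition holomorphic_section ::
  "('a::complex_inner \<Rightarrow> 'a) \<Rightarrow> complex set \<Rightarrow> (complex \<Rightarrow> 'a) \<Rightarrow> bool" where
  "holomorphic_section T U s \<longleftrightarrow> vholomorphic_on s U \<and> (\<forall>w\<in>U. s w \<in> eigenspace T w)"

definition nonvanishing_section ::
  "('a::complex_inner \<Rightarrow> 'a) \<Rightarrow> complex set \<Rightarrow> (complex \<Rightarrow> 'a) \<Rightarrow> bool" where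
  "nonvanishing_section T U s \<longleftrightarrow> holomorphic_section T U s \<and> (\<forall>w\<in>U. s w \<noteq> 0)"

text \<open>The Wirtinger derivatives $\partial/\partial z = (\partial_x - i\,\partial_y)/2$ and
  $\partial/\partial\bar z = (\partial_x + i\,\partial_y)/2$.\<close>

definition partial_x :: "(complex \<Rightarrow> complex) \<Rightarrow> complex \<Rightarrow> complex" where
  "partial_x f z = vector_derivative (\<lambda>t. f (z + of_real t)) (at 0)"

definition partial_y :: "(complex \<Rightarrow> complex) \<Rightarrow> complex \<Rightarrow> complex" where
  "partial_y f z = vector_derivative (\<lambda>t. f (z + \<i> * of_real t)) (at 0)"

definition wirtinger :: "(complex \<Rightarrow> complex) \<Rightarrow> complex \<Rightarrow> complex" where
  "wirtinger f z = (partial_x f z - \<i> * partial_y f z) / 2"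

definition wirtinger_bar :: "(complex \<Rightarrow> complex) \<Rightarrow> complex \<Rightarrow> complex" where
  "wirtinger_bar f z = (partial_x f z + \<i> * partial_y f z) / 2"

definition section_curvature :: "(complex \<Rightarrow> 'a::real_normed_vector) \<Rightarrow> complex \<Rightarrow> complex" where
  "section_curvature \<gamma> z =
     - wirtinger (wirtinger_bar (\<lambda>w. complex_of_real (ln ((norm (\<gamma> w))\<^sup>2)))) z"

text \<open>For \<open>A\<close> in $B_1(\Omega)$ and \<open>z \<in> \<Omega>\<close>, all nowhere vanishing holomorphic sections of $E_A$
  near \<open>z\<close> give the same value, so the description below denotes it.\<close>

definition curvature ::
  "complex set \<Rightarrow> ('a::separable_chilbert \<Rightarrow> 'a) \<Rightarrow> complex \<Rightarrow> complex" where
  "curvature \<Omega> A z =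
     (THE k. \<exists>U \<gamma>. open U \<and> z \<in> U \<and> U \<subseteq> \<Omega> \<and> nonvanishing_section A U \<gamma> \<and>
                   k = section_curvature \<gamma> z)"

end

theory Submission
  imports Defs "HOL-Complex_Analysis.Conformal_Mappings"
begin

text \<open>A unitary \<open>U\<close> intertwining two operators of the class is block diagonal.  Write \<open>V\<close> for its
  inverse and let \<open>U\<^sub>1\<^sub>0\<close>, \<open>V\<^sub>1\<^sub>0\<close> be the lower left corners.  The double commutator of \<open>T\<^sub>0\<close> with
  \<open>V\<^sub>0\<^sub>0 U\<^sub>0\<^sub>0\<close> is \<open>2 S V\<^sub>1\<^sub>0 S' U\<^sub>1\<^sub>0\<close>, which commutes with \<open>T\<^sub>0\<close>; a pointwise Kleinecke--Shirokov
  argument makes all its eigenvalues on the vectors \<open>S (t\<^sub>1 w)\<close> vanish, which forces \<open>U\<^sub>1\<^sub>0 = 0\<close>.  By symmetry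
  \<open>V\<^sub>1\<^sub>0 = 0\<close>, and \<open>V\<close> is the adjoint of \<open>U\<close>, so \<open>U\<close> is diagonal and preserves all the invariants.

  Conversely, on a small disc where \<open>S (t\<^sub>1 w) \<noteq> 0\<close>, equality of either curvature gives a holomorphic
  \<open>\<psi>\<close> with, say, \<open>norm (t\<^sub>1 w) = \<bar>\<psi> w\<bar> * norm (t\<^sub>1' w)\<close>, and the ratio condition transfers this to
  \<open>S (t\<^sub>1 w)\<close>.  Polarization yields equal Gram matrices for \<open>t\<^sub>1\<close> and \<open>\<psi> t\<^sub>1'\<close> and for their images, and
  since these families are total they define the two diagonal entries of a unitary.\<close>

section \<open>Complex inner product spaces\<close>

text \<open>The corner \<open>U10\<close> satisfies \<open>T1' U10 = U10 T0\<close>, and an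
  intertwiner of this kind can well be non-zero in general. What excludes it is the invertibility of
  \<open>U\<close> together with the corners \<open>S\<close> and \<open>S'\<close>. The relations
  \<open>T0' U00 = U00 T0 - S' U10\<close> and \<open>T0 V00 = V00 T0' - S V10\<close> measure how
  far the diagonal entries are from intertwining, and two commutators with \<open>T0\<close> isolate
  the product of the two defects. Since eigenspaces are one-dimensional, this product acts on
  \<open>S (t w)\<close> as a scalar built from the coefficient of \<open>U10\<close> there and the
  coefficient of \<open>V10\<close> on \<open>S' (t' w)\<close>; invertibility makes the second
  non-zero as soon as the first is.

  In the converse two separate unitaries are built, and they must fit together through
  \<open>S\<close>. One \<psi> therefore has to serve \<open>t\<close> and \<open>S t\<close> at
  once, which is the role of the ratio condition. The section \<open>S t\<close> may have zeros, so
  it trivializes the bundle of \<open>T0\<close> only locally; the identity theorem and the density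
  of eigenvectors over any non-empty open set recover the whole space.\<close>

lemma cinner_scaleC_right: "cinner x (a *\<^sub>C y) = cnj a * cinner x y"
  by (metis cinner_commute cinner_scaleC_left complex_cnj_mult)

lemma cinner_add_right: "cinner x (y + z) = cinner x y + cinner x z"
  by (metis cinner_commute cinner_add_left complex_cnj_add)

lemma cinner_zero_left [simp]: "cinner 0 x = 0"
  by (metis add_0 add_cancel_right_left cinner_add_left)

lemma cinner_zero_right [simp]: "cinner x 0 = 0"
  by (metis cinner_commute cinner_zero_left complex_cnj_zero)

lemma cinner_self: "cinner x x = complex_of_real ((norm x)\<^sup>2)"
proof -
  have "Im (cinner x x) = 0"
    by (metis Reals_cnj_iff cinner_commute complex_is_Real_iff)
  then show ?thesis
    by (simp add: complex_eq_iff power2_norm_eq_inner inner_eq_Re_cinner)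
qed

lemma cinner_self_eq_0 [simp]: "cinner x x = 0 \<longleftrightarrow> x = 0"
  by (simp add: cinner_self)

lemma norm_scaleC [simp]: "norm (a *\<^sub>C x) = cmod a * norm (x::'a::complex_inner)"
proof -
  have "complex_of_real ((norm (a *\<^sub>C x))\<^sup>2) = complex_of_real ((cmod a * norm x)\<^sup>2)"
  proof -
    have "complex_of_real ((norm (a *\<^sub>C x))\<^sup>2) = (a * cnj a) * cinner x x"
      unfolding cinner_self[symmetric] by (simp add: cinner_scaleC_left cinner_scaleC_right)
    then show ?thesis
      by (simp add: cinner_self power_mult_distrib flip: complex_norm_square)
  qed
  then show ?thesis
    by (simp only: of_real_eq_iff power2_eq_iff_nonneg norm_ge_zero mult_nonneg_nonneg)
qed

lemma norm_cinner_le: "cmod (cinner x y) \<le> norm x * norm y"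
proof (cases "cinner x y = 0")
  case False
  \<comment> \<open>The phase that rotates \<open>cinner x y\<close> onto the positive real axis, so
    that the real Cauchy-Schwarz inequality applies to \<open>c *\<^sub>C x\<close> and
    \<open>y\<close>.\<close>
  define c where "c = cnj (cinner x y) / cmod (cinner x y)"
  have c: "cmod c = 1"
    using False by (simp add: c_def norm_divide)
  have "c * cinner x y = cmod (cinner x y)"
    using False by (simp add: c_def field_simps complex_norm_square[symmetric] power2_eq_square)
  then have "cmod (cinner x y) = Re (cinner (c *\<^sub>C x) y)"
    by (simp add: cinner_scaleC_left)
  also have "\<dots> \<le> norm (c *\<^sub>C x) * norm y"
    unfolding inner_eq_Re_cinner[symmetric] by (rule norm_cauchy_schwarz)
  finally show ?thesis
    using c by simp
qed auto

lemma bounded_bilinear_cinner: "bounded_bilinear (cinner :: 'a::complex_inner \<Rightarrow> 'a \<Rightarrow> complex)"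
proof
  show "\<exists>K. \<forall>a b :: 'a. norm (cinner a b) \<le> norm a * norm b * K"
    using norm_cinner_le by (metis mult.right_neutral)
qed (simp_all add: cinner_add_left cinner_add_right scaleR_scaleC cinner_scaleC_left
    cinner_scaleC_right scaleR_conv_of_real)

lemma bounded_bilinear_scaleC:
  "bounded_bilinear (scaleC :: complex \<Rightarrow> 'a::complex_inner \<Rightarrow> 'a)"
proof
  show "\<exists>K. \<forall>a. \<forall>b::'a. norm (a *\<^sub>C b) \<le> norm a * norm b * K"
    by (metis mult.right_neutral norm_scaleC order_refl)
qed (simp_all add: scaleC_add_left scaleC_add_right scaleR_scaleC scaleC_scaleC
    scaleR_conv_of_real mult.commute)

lemmas has_derivative_cinner = bounded_bilinear.FDERIV[OF bounded_bilinear_cinner]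
lemmas has_derivative_scaleC = bounded_bilinear.FDERIV[OF bounded_bilinear_scaleC]
lemmas tendsto_cinner = bounded_bilinear.tendsto[OF bounded_bilinear_cinner]
lemmas bounded_linear_cinner_left = bounded_bilinear.bounded_linear_left[OF bounded_bilinear_cinner]
lemmas bounded_linear_scaleC_right = bounded_bilinear.bounded_linear_right[OF bounded_bilinear_scaleC]
lemmas cinner_diff_left = bounded_bilinear.diff_left[OF bounded_bilinear_cinner]
lemmas cinner_diff_right = bounded_bilinear.diff_right[OF bounded_bilinear_cinner]
lemmas scaleC_diff_right = bounded_bilinear.diff_right[OF bounded_bilinear_scaleC]
lemmas scaleC_zero_left [simp] = bounded_bilinear.zero_left[OF bounded_bilinear_scaleC]
lemmas scaleC_zero_right [simp] = bounded_bilinear.zero_right[OF bounded_bilinear_scaleC]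

lemma scaleC_eq_0_iff [simp]: "a *\<^sub>C (x::'a::complex_inner) = 0 \<longleftrightarrow> a = 0 \<or> x = 0"
  by (metis mult_eq_0_iff norm_eq_zero norm_scaleC)

section \<open>Closed complex spans, nearest points and density\<close>

lemma cspan_closure_scaleC:
  assumes "x \<in> closure (cspan (A::'a::complex_inner set))" shows "c *\<^sub>C x \<in> closure (cspan A)"
proof -
  obtain f where f: "\<And>n. f n \<in> cspan A" "f \<longlonglongrightarrow> x"
    using assms by (auto simp: closure_sequential)
  have "(\<lambda>n. c *\<^sub>C f n) \<longlonglongrightarrow> c *\<^sub>C x"
    by (intro bounded_linear.tendsto[OF bounded_linear_scaleC_right] f)
  moreover have "\<And>n. c *\<^sub>C f n \<in> cspan A"
    using f by (simp add: complex_vector.span_scale)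
  ultimately show ?thesis
    unfolding closure_sequential by (intro exI[of _ "\<lambda>n. c *\<^sub>C f n"]) simp
qed

lemma cspan_closure_add:
  assumes "x \<in> closure (cspan (A::'a::complex_inner set))" "y \<in> closure (cspan A)"
  shows "x + y \<in> closure (cspan A)"
proof -
  obtain f g where "\<And>n. f n \<in> cspan A" "f \<longlonglongrightarrow> x" "\<And>n. g n \<in> cspan A" "g \<longlonglongrightarrow> y"
    using assms by (auto simp: closure_sequential)
  then have "(\<lambda>n. f n + g n) \<longlonglongrightarrow> x + y" "\<And>n. f n + g n \<in> cspan A"
    by (simp_all add: complex_vector.span_add tendsto_add)
  then show ?thesis
    unfolding closure_sequential by (intro exI[of _ "\<lambda>n. f n + g n"]) simp
qed

text \<open>Bounded closed sets need not be compact here, so completeness does the work: convexity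
  keeps midpoints of a minimizing sequence in \<open>M\<close>, and the parallelogram identity then
  makes the sequence Cauchy.\<close>

lemma closest_point_exists_complete:
  fixes M :: "'a::{real_inner, complete_space} set"
  assumes "closed M" "convex M" "M \<noteq> {}"
  obtains m where "m \<in> M" "\<And>y. y \<in> M \<Longrightarrow> norm (p - m) \<le> norm (p - y)"
proof -
  define d where "d = infdist p M"
  have dle: "d \<le> norm (p - y)" if "y \<in> M" for y
    using infdist_le[OF that, of p] by (simp add: d_def dist_norm)
  have d0: "0 \<le> d"
    by (simp add: d_def infdist_nonneg)
  have "\<exists>y\<in>M. norm (p - y) < d + 1 / Suc n" for n
  proof (rule ccontr)
    assume "\<not> ?thesis"
    then have "d + 1 / Suc n \<le> infdist p M"
      using assms(3) by (auto simp: infdist_def dist_norm not_less intro!: cINF_greatest)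
    then show False
      by (simp add: d_def)
  qed
  then obtain y where y: "\<And>n. y n \<in> M" "\<And>n. norm (p - y n) < d + 1 / Suc n"
    by metis
  have par: "(norm (y i - y j))\<^sup>2 \<le> 2 * (norm (p - y i))\<^sup>2 + 2 * (norm (p - y j))\<^sup>2 - 4 * d\<^sup>2" for i j
  proof -
    have "(1/2) *\<^sub>R y i + (1/2) *\<^sub>R y j \<in> M"
      using assms(2) y(1) by (simp add: convexD)
    from dle[OF this] have "d \<le> norm (p - ((1/2) *\<^sub>R y i + (1/2) *\<^sub>R y j))" .
    then have "d\<^sup>2 \<le> (norm (p - ((1/2) *\<^sub>R y i + (1/2) *\<^sub>R y j)))\<^sup>2"
      using d0 by (simp add: power_mono)
    then show ?thesis
      by (simp add: power2_norm_eq_inner inner_diff_left inner_diff_right inner_add_left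
          inner_add_right inner_commute algebra_simps)
  qed
  have lim: "(\<lambda>n. d + 1 / Suc n) \<longlonglongrightarrow> d"
    using tendsto_add[OF tendsto_const LIMSEQ_inverse_real_of_nat, of d] by (simp add: inverse_eq_divide)
  have sq: "(\<lambda>n. (d + 1 / Suc n)\<^sup>2 - d\<^sup>2) \<longlonglongrightarrow> 0"
    using tendsto_diff[OF tendsto_power[OF lim, of 2] tendsto_const[of "d\<^sup>2"]] by simp
  have "Cauchy y"
  proof (rule metric_CauchyI)
    fix e :: real assume "e > 0"
    then have "eventually (\<lambda>n. (d + 1 / Suc n)\<^sup>2 - d\<^sup>2 < e\<^sup>2 / 4) sequentially"
      by (intro order_tendstoD(2)[OF sq]) simp
    then obtain N where N: "\<And>n. n \<ge> N \<Longrightarrow> (d + 1 / Suc n)\<^sup>2 - d\<^sup>2 < e\<^sup>2 / 4"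
      by (auto simp: eventually_sequentially)
    have "dist (y i) (y j) < e" if "i \<ge> N" "j \<ge> N" for i j
    proof -
      have "(norm (p - y n))\<^sup>2 \<le> (d + 1 / Suc n)\<^sup>2" for n
        using y(2)[of n] by (intro power_mono) auto
      from this[of i] this[of j] have "(norm (y i - y j))\<^sup>2 < e\<^sup>2"
        using par[of i j] N[OF that(1)] N[OF that(2)] by linarith
      then show ?thesis
        using \<open>e > 0\<close> by (simp add: dist_norm power2_less_imp_less)
    qed
    then show "\<exists>N. \<forall>m\<ge>N. \<forall>n\<ge>N. dist (y m) (y n) < e"
      by blast
  qed
  then obtain m where m: "y \<longlonglongrightarrow> m"
    by (auto simp: Cauchy_convergent_iff convergent_def)
  have "m \<in> M"
    using assms(1) m y(1) closed_sequentially by blast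
  moreover have "norm (p - m) \<le> d"
  proof (rule LIMSEQ_le[OF _ lim])
    show "(\<lambda>n. norm (p - y n)) \<longlonglongrightarrow> norm (p - m)"
      by (intro tendsto_intros m)
  qed (use y(2) less_imp_le in blast)
  ultimately show ?thesis
    using dle that by (meson order_trans)
qed

text \<open>If \<open>m\<close> is the point of the closed span nearest to \<open>p\<close>, then
  \<open>p - m\<close> is orthogonal to \<open>A\<close>, because otherwise moving \<open>m\<close>
  along some \<open>a\<close> in \<open>A\<close> would come closer. The hypothesis then gives
  \<open>p = m\<close>.\<close>

lemma closure_cspan_eq_UNIV:
  fixes A :: "'a::{complex_inner, complete_space} set"
  assumes "\<And>x. (\<And>a. a \<in> A \<Longrightarrow> cinner a x = 0) \<Longrightarrow> x = 0"
  shows "closure (cspan A) = UNIV"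
proof -
  let ?M = "closure (cspan A)"
  have "p \<in> ?M" for p
  proof -
    have "convex ?M"
      unfolding convex_def by (simp add: scaleR_scaleC cspan_closure_add cspan_closure_scaleC)
    moreover have "?M \<noteq> {}"
      using complex_vector.span_zero closure_subset by blast
    ultimately obtain m where m: "m \<in> ?M" "\<And>y. y \<in> ?M \<Longrightarrow> norm (p - m) \<le> norm (p - y)"
      using closest_point_exists_complete[of ?M p] by auto
    have "cinner a (p - m) = 0" if "a \<in> A" for a
    proof (rule ccontr)
      assume nz: "cinner a (p - m) \<noteq> 0"
      define q where "q = p - m"
      \<comment> \<open>The coefficient of the orthogonal projection of \<open>q\<close> onto
        \<open>a\<close>; subtracting it lowers the squared norm by exactly
        \<open>(cmod (cinner q a))\<^sup>2 / (norm a)\<^sup>2\<close>.\<close>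
      define c where "c = cinner q a / (norm a)\<^sup>2"
      have a0: "norm a \<noteq> 0"
        using nz by auto
      have "a \<in> ?M"
        using that closure_subset complex_vector.span_base by blast
      then have "norm q \<le> norm (p - (m + c *\<^sub>C a))"
        using m unfolding q_def by (intro m(2) cspan_closure_add cspan_closure_scaleC) auto
      then have "norm q \<le> norm (q - c *\<^sub>C a)"
        by (simp add: q_def algebra_simps)
      then have le: "(norm q)\<^sup>2 \<le> (norm (q - c *\<^sub>C a))\<^sup>2"
        by (simp add: power_mono)
      have "complex_of_real ((norm (q - c *\<^sub>C a))\<^sup>2) =
          complex_of_real ((norm q)\<^sup>2) - cnj c * cinner q a - c * cinner a q +
          c * cnj c * complex_of_real ((norm a)\<^sup>2)"
        unfolding cinner_self[symmetric] cinner_diff_left cinner_diff_right cinner_scaleC_left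
          cinner_scaleC_right by (simp add: algebra_simps)
      also have "cinner a q = cnj (cinner q a)"
        by (rule cinner_commute)
      also have "complex_of_real ((norm q)\<^sup>2) - cnj c * cinner q a - c * cnj (cinner q a) +
            c * cnj c * complex_of_real ((norm a)\<^sup>2) =
          complex_of_real ((norm q)\<^sup>2 - (cmod (cinner q a))\<^sup>2 / (norm a)\<^sup>2)"
      proof -
        have "cnj c * cinner q a = c * cnj (cinner q a)"
          by (simp add: c_def)
        moreover have "cnj c * complex_of_real ((norm a)\<^sup>2) = cnj (cinner q a)"
          using a0 by (simp add: c_def)
        moreover have "c * cnj (cinner q a) = of_real ((cmod (cinner q a))\<^sup>2 / (norm a)\<^sup>2)"
          by (simp add: c_def flip: complex_norm_square)
        ultimately show ?thesis
          by (simp only: of_real_diff mult.assoc) simp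
      qed
      finally have "(norm (q - c *\<^sub>C a))\<^sup>2 = (norm q)\<^sup>2 - (cmod (cinner q a))\<^sup>2 / (norm a)\<^sup>2"
        using of_real_eq_iff by blast
      moreover have "(cmod (cinner q a))\<^sup>2 / (norm a)\<^sup>2 > 0"
        using nz a0 cinner_commute[of q a] by (simp add: q_def)
      ultimately show False
        using le by linarith
    qed
    then have "p - m = 0"
      by (rule assms)
    then show ?thesis
      using m(1) by simp
  qed
  then show ?thesis
    by blast
qed

lemma eq_on_dense_span:
  fixes F G :: "'a::complex_inner \<Rightarrow> 'b::complex_inner"
  assumes "bounded_clinear F" "bounded_clinear G" "closure (cspan A) = UNIV"
    and "\<And>a. a \<in> A \<Longrightarrow> F a = G a"
  shows "F x = G x"
proof -
  have bl: "bounded_linear F" "bounded_linear G" and sc: "\<And>c x. F (c *\<^sub>C x) = c *\<^sub>C F x" "\<And>c x. G (c *\<^sub>C x) = c *\<^sub>C G x"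
    using assms by (auto simp: bounded_clinear_def)
  interpret F: bounded_linear F by fact
  interpret G: bounded_linear G by fact
  have span: "F y = G y" if "y \<in> cspan A" for y
    using that
  proof (induction rule: complex_vector.span_induct_alt)
    case base then show ?case by (simp add: F.zero G.zero)
  next
    case (step c a z) then show ?case
      by (simp add: F.add G.add sc assms(4))
  qed
  have "x \<in> closure (cspan A)"
    using assms(3) by simp
  then obtain f where f: "\<And>n. f n \<in> cspan A" "f \<longlonglongrightarrow> x"
    by (auto simp: closure_sequential)
  have "(\<lambda>n. F (f n)) \<longlonglongrightarrow> F x" "(\<lambda>n. G (f n)) \<longlonglongrightarrow> G x"
    using f(2) F.tendsto G.tendsto by blast+
  then show ?thesis
    using span[OF f(1)] LIMSEQ_unique by fastforce
qed

lemma orthogonal_dense_span: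
  fixes x :: "'a::complex_inner"
  assumes "closure (cspan A) = UNIV" "\<And>a. a \<in> A \<Longrightarrow> cinner a x = 0"
  shows "x = 0"
proof -
  have span: "cinner y x = 0" if "y \<in> cspan A" for y
    using that
  proof (induction rule: complex_vector.span_induct_alt)
    case (step c a z) then show ?case
      by (simp add: cinner_add_left cinner_scaleC_left assms(2))
  qed simp
  have "x \<in> closure (cspan A)"
    using assms(1) by simp
  then obtain f where f: "\<And>n. f n \<in> cspan A" "f \<longlonglongrightarrow> x"
    by (auto simp: closure_sequential)
  have "(\<lambda>n. cinner (f n) x) \<longlonglongrightarrow> cinner x x"
    by (intro bounded_linear.tendsto[OF bounded_linear_cinner_left] f)
  then show ?thesis
    using span[OF f(1)] LIMSEQ_unique by fastforce
qed

section \<open>Bounded complex-linear maps and unitaries from Gram matrices\<close>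

lemma bounded_clinearD:
  assumes "bounded_clinear A"
  shows "bounded_linear A" "A (x + y) = A x + A y" "A (c *\<^sub>C x) = c *\<^sub>C A x" "A 0 = 0"
    "A (x - y) = A x - A y" "A (- x) = - A x"
proof -
  show bl: "bounded_linear A"
    using assms by (simp add: bounded_clinear_def)
  interpret bounded_linear A by fact
  show "A (x + y) = A x + A y" "A (c *\<^sub>C x) = c *\<^sub>C A x" "A 0 = 0" "A (x - y) = A x - A y" "A (- x) = - A x"
    using assms by (simp_all add: bounded_clinear_def add zero diff neg)
qed

lemma bounded_clinear_compose:
  "bounded_clinear A \<Longrightarrow> bounded_clinear B \<Longrightarrow> bounded_clinear (\<lambda>x. A (B x))"
  by (auto simp: bounded_clinear_def bounded_linear_compose)

lemma bounded_clinear_add: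
  "bounded_clinear A \<Longrightarrow> bounded_clinear B \<Longrightarrow> bounded_clinear (\<lambda>x. A x + B x)"
  by (auto simp: bounded_clinear_def bounded_linear_add scaleC_add_right)

lemma bounded_clinear_scaleC: "bounded_clinear A \<Longrightarrow> bounded_clinear (\<lambda>x. c *\<^sub>C A x)"
  using bounded_linear_compose[OF bounded_linear_scaleC_right, of A c]
  by (auto simp: bounded_clinear_def scaleC_scaleC mult.commute)

lemma bounded_clinear_ident: "bounded_clinear (\<lambda>x. x)"
  by (simp add: bounded_clinear_def bounded_linear_ident)

lemma bounded_clinear_zero: "bounded_clinear (\<lambda>x. 0)"
  by (simp add: bounded_clinear_def bounded_linear_zero)

lemma bounded_clinear_fst: "bounded_clinear fst"
  and bounded_clinear_snd: "bounded_clinear snd"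
  by (simp_all add: bounded_clinear_def scaleC_prod_def bounded_linear_fst bounded_linear_snd)

lemma bounded_clinear_Pair:
  "bounded_clinear A \<Longrightarrow> bounded_clinear B \<Longrightarrow> bounded_clinear (\<lambda>x. (A x, B x))"
  by (auto simp: bounded_clinear_def scaleC_prod_def bounded_linear_Pair)

lemma bounded_clinear_minus_scaleC:
  assumes "bounded_clinear A" shows "bounded_clinear (\<lambda>x. A x - w *\<^sub>C x)"
  using bounded_clinear_add[OF assms bounded_clinear_scaleC[OF bounded_clinear_ident, of "- w"]]
  by simp

text \<open>The bound makes \<open>h\<close> injective with bounded inverse on the span, so lifts of
  a convergent sequence are Cauchy. Applied to the two coordinate projections of a graph, this gives
  total domain and full range of the map it describes.\<close>

lemma surj_on_closure_cspan:
  fixes h :: "'a::{complex_inner, complete_space} \<Rightarrow> 'b::complex_inner"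
  assumes h: "bounded_clinear h" and dense: "closure (cspan (h ` P)) = UNIV"
    and K: "\<And>p. p \<in> cspan P \<Longrightarrow> norm p \<le> K * norm (h p)"
  shows "\<exists>p\<in>closure (cspan P). h p = x"
proof -
  note l = bounded_clinearD[OF h]
  have lift: "\<exists>p\<in>cspan P. h p = y" if "y \<in> cspan (h ` P)" for y
    using that
  proof (induction rule: complex_vector.span_induct_alt)
    case base then show ?case
      using complex_vector.span_zero l by blast
  next
    case (step c a z)
    then obtain p q where "p \<in> P" "a = h p" "q \<in> cspan P" "h q = z"
      by blast
    then have "c *\<^sub>C p + q \<in> cspan P" "h (c *\<^sub>C p + q) = c *\<^sub>C a + z"
      by (simp_all add: l complex_vector.span_add complex_vector.span_scale complex_vector.span_base)
    then show ?case by blast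
  qed
  have "x \<in> closure (cspan (h ` P))"
    using dense by simp
  then obtain y where y: "\<And>n. y n \<in> cspan (h ` P)" "y \<longlonglongrightarrow> x"
    unfolding closure_sequential by blast
  obtain p where p: "\<And>n. p n \<in> cspan P" "\<And>n. h (p n) = y n"
    using lift[OF y(1)] by metis
  have "Cauchy p"
  proof (rule metric_CauchyI)
    fix e :: real assume "e > 0"
    have "Cauchy y"
      using y(2) LIMSEQ_imp_Cauchy by blast
    \<comment> \<open>The sign of \<open>K\<close> is not known; \<open>\<bar>K\<bar> + 1\<close> is
      a positive constant above it by which one can divide.\<close>
    then obtain N where N: "\<And>m n. m \<ge> N \<Longrightarrow> n \<ge> N \<Longrightarrow> dist (y m) (y n) < e / (\<bar>K\<bar> + 1)"
      using metric_CauchyD[of y "e / (\<bar>K\<bar> + 1)"] \<open>e > 0\<close> by auto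
    have "dist (p m) (p n) < e" if "m \<ge> N" "n \<ge> N" for m n
    proof -
      have "norm (p m - p n) \<le> K * norm (y m - y n)"
        using K[OF complex_vector.span_diff[OF p(1) p(1)], of m n] by (simp add: l p)
      also have "\<dots> \<le> (\<bar>K\<bar> + 1) * norm (y m - y n)"
        by (intro mult_right_mono) auto
      also have "\<dots> < e"
        using N[OF that] pos_less_divide_eq[of "\<bar>K\<bar> + 1"] by (simp add: dist_norm mult.commute)
      finally show ?thesis
        by (simp add: dist_norm)
    qed
    then show "\<exists>N. \<forall>m\<ge>N. \<forall>n\<ge>N. dist (p m) (p n) < e"
      by blast
  qed
  then obtain q where q: "p \<longlonglongrightarrow> q"
    by (auto simp: Cauchy_convergent_iff convergent_def)
  have "y \<longlonglongrightarrow> h q"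
    using bounded_linear.tendsto[OF l(1) q] p(2) by simp
  then have "h q = x"
    using y(2) LIMSEQ_unique by blast
  moreover have "q \<in> closure (cspan P)"
    using p(1) q closure_sequential by blast
  ultimately show ?thesis by blast
qed

text \<open>The closed span of the pairs \<open>(f i, g i)\<close> in the product space is the graph of the unitary.\<close>

theorem unitary_of_gram_eq:
  fixes f :: "'i \<Rightarrow> 'a::{complex_inner, complete_space}"
    and g :: "'i \<Rightarrow> 'b::{complex_inner, complete_space}"
  assumes gram: "\<And>i j. i \<in> I \<Longrightarrow> j \<in> I \<Longrightarrow> cinner (f i) (f j) = cinner (g i) (g j)"
    and dense: "closure (cspan (f ` I)) = UNIV" "closure (cspan (g ` I)) = UNIV"
  obtains U where "unitary U" "\<And>i. i \<in> I \<Longrightarrow> U (f i) = g i"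
proof -
  define P where "P = (\<lambda>i. (f i, g i)) ` I"
  define G where "G = closure (cspan P)"
  \<comment> \<open>The defect of isometry as one sesquilinear form on pairs. It vanishes on
    \<open>P\<close> by the Gram condition, then on the span by linearity in each slot, then on the
    closure by continuity.\<close>
  let ?b = "\<lambda>p q. cinner (fst p) (fst q) - cinner (snd p) (snd q)"
  have b_left: "?b (c *\<^sub>C p + p') q = c * ?b p q + ?b p' q" for c p p' q
    by (simp add: scaleC_prod_def cinner_add_left cinner_scaleC_left algebra_simps)
  have b_commute: "?b p q = cnj (?b q p)" for p q
    by (metis cinner_commute complex_cnj_diff)
  have P: "?b p q = 0" if "p \<in> P" "q \<in> P" for p q
    using that gram by (auto simp: P_def)
  have span1: "?b p q = 0" if "p \<in> cspan P" "q \<in> P" for p q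
    using that(1)
  proof (induction rule: complex_vector.span_induct_alt)
    case (step c a z)
    then show ?case
      using P[OF _ that(2)] unfolding b_left by simp
  qed simp
  have span2: "?b p q = 0" if "p \<in> cspan P" "q \<in> cspan P" for p q
    using that(1)
  proof (induction rule: complex_vector.span_induct_alt)
    case (step c a z)
    then show ?case
      using span1[OF that(2) step(1)] b_commute[of a q] unfolding b_left by simp
  qed simp
  have iso: "cinner (fst p) (fst q) = cinner (snd p) (snd q)" if pq: "p \<in> G" "q \<in> G" for p q
  proof -
    obtain u where u: "\<And>n. u n \<in> cspan P" "u \<longlonglongrightarrow> p"
      using pq(1) unfolding G_def closure_sequential by blast
    obtain v where v: "\<And>n. v n \<in> cspan P" "v \<longlonglongrightarrow> q"
      using pq(2) unfolding G_def closure_sequential by blast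
    have "(\<lambda>n. ?b (u n) (v n)) \<longlonglongrightarrow> ?b p q"
      by (intro tendsto_diff tendsto_cinner tendsto_fst tendsto_snd u v)
    then have "?b p q = 0"
      using span2[OF u(1) v(1)] LIMSEQ_unique by fastforce
    then show ?thesis by simp
  qed
  have norms: "norm (fst p) = norm (snd p)" if "p \<in> G" for p
    using iso[OF that that] unfolding cinner_self of_real_eq_iff by simp
  have sub: "cspan P \<subseteq> G"
    by (simp add: G_def closure_subset)
  \<comment> \<open>The norm of a pair is at most the sum of the norms of its components, and on
    \<open>G\<close> these two are equal; hence the factor 2.\<close>
  have bound: "norm p \<le> 2 * norm (fst p)" "norm p \<le> 2 * norm (snd p)" if "p \<in> cspan P" for p
    using norm_Pair_le[of "fst p" "snd p"] norms[of p] sub that by auto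
  have ex1: "\<exists>y. (x, y) \<in> G" for x
    using surj_on_closure_cspan[OF bounded_clinear_fst, of P 2 x] dense(1) bound(1)
    by (force simp: P_def G_def image_image)
  have ex2: "\<exists>x. (x, y) \<in> G" for y
    using surj_on_closure_cspan[OF bounded_clinear_snd, of P 2 y] dense(2) bound(2)
    by (force simp: P_def G_def image_image)
  have G_add: "p + q \<in> G" and G_scale: "c *\<^sub>C p \<in> G" if "p \<in> G" "q \<in> G" for p q c
    using that by (simp_all add: G_def cspan_closure_add cspan_closure_scaleC)
  \<comment> \<open>The difference of the two pairs lies in \<open>G\<close> and has first component
    0, so its second component has norm 0.\<close>
  have unique: "y = y'" if "(x, y) \<in> G" "(x, y') \<in> G" for x y y'
  proof -
    have "(x, y) + (-1) *\<^sub>C (x, y') \<in> G"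
      using that by (intro G_add G_scale)
    from norms[OF this] show ?thesis
      by (simp add: scaleC_prod_def)
  qed
  define U where "U x = (SOME y. (x, y) \<in> G)" for x
  have U: "(x, U x) \<in> G" for x
    unfolding U_def by (rule someI_ex[OF ex1])
  have U_eq: "U x = y" if "(x, y) \<in> G" for x y
    using unique[OF U that] .
  have add: "U (x + y) = U x + U y" for x y
    using G_add[OF U[of x] U[of y]] by (intro U_eq) simp
  have scale: "U (c *\<^sub>C x) = c *\<^sub>C U x" for c x
    using G_scale[OF U[of x] U[of x], of c] by (intro U_eq) (simp add: scaleC_prod_def)
  have norm: "norm (U x) = norm x" for x
    using norms[OF U[of x]] by simp
  have "bounded_clinear U"
    unfolding bounded_clinear_def
    by (intro conjI allI bounded_linear_intro[of U 1]) (simp_all add: add scale norm scaleR_scaleC)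
  moreover have "surj U"
    by (rule surjI[of U "\<lambda>y. SOME x. (x, y) \<in> G"], rule U_eq, rule someI_ex, rule ex2)
  moreover have "cinner (U x) (U y) = cinner x y" for x y
    using iso[OF U[of x] U[of y]] by simp
  ultimately have "unitary U"
    by (simp add: unitary_def)
  moreover have "U (f i) = g i" if "i \<in> I" for i
  proof (rule U_eq)
    have "(f i, g i) \<in> P"
      using that by (simp add: P_def)
    then show "(f i, g i) \<in> G"
      using sub complex_vector.span_base by blast
  qed
  ultimately show ?thesis
    using that by blast
qed

section \<open>Holomorphic maps into a Hilbert space\<close>

definition vderiv :: "(complex \<Rightarrow> 'a::complex_inner) \<Rightarrow> complex \<Rightarrow> 'a" where
  "vderiv f z = (SOME v. (f has_derivative (\<lambda>h. h *\<^sub>C v)) (at z))"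

lemma vholomorphic_on_open:
  "open U \<Longrightarrow> vholomorphic_on f U \<longleftrightarrow> (\<forall>z\<in>U. \<exists>v. (f has_derivative (\<lambda>h. h *\<^sub>C v)) (at z))"
  by (simp add: vholomorphic_on_def at_within_open_NO_MATCH)

lemma vholomorphic_on_subset:
  "vholomorphic_on f U \<Longrightarrow> open U \<Longrightarrow> open V \<Longrightarrow> V \<subseteq> U \<Longrightarrow> vholomorphic_on f V"
  by (auto simp: vholomorphic_on_open)

lemma has_derivative_vderiv:
  assumes "vholomorphic_on f U" "open U" "z \<in> U"
  shows "(f has_derivative (\<lambda>h. h *\<^sub>C vderiv f z)) (at z)"
  unfolding vderiv_def by (rule someI_ex) (use assms vholomorphic_on_open in blast)

lemma vderiv_eq:
  assumes "(f has_derivative (\<lambda>h. h *\<^sub>C v)) (at z)"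
  shows "vderiv f z = v"
proof -
  have "(f has_derivative (\<lambda>h. h *\<^sub>C vderiv f z)) (at z)"
    unfolding vderiv_def using assms by (rule someI)
  from has_derivative_unique[OF this assms] have "1 *\<^sub>C vderiv f z = 1 *\<^sub>C v"
    by meson
  then show ?thesis
    by (simp add: scaleC_one)
qed

lemma vholomorphic_on_continuous_on:
  assumes "vholomorphic_on f U" "open U"
  shows "continuous_on U f"
  using has_derivative_vderiv[OF assms] has_derivative_continuous
  by (metis continuous_at_imp_continuous_on)

lemma bounded_clinear_vholomorphic_on:
  assumes "bounded_clinear A" "vholomorphic_on f U" "open U"
  shows "vholomorphic_on (\<lambda>z. A (f z)) U"
    and "z \<in> U \<Longrightarrow> vderiv (\<lambda>z. A (f z)) z = A (vderiv f z)"
proof -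
  have *: "((\<lambda>z. A (f z)) has_derivative (\<lambda>h. h *\<^sub>C A (vderiv f z))) (at z)" if "z \<in> U" for z
    using bounded_linear.has_derivative[of A f, OF _ has_derivative_vderiv[OF assms(2,3) that]] assms(1)
    by (simp add: bounded_clinear_def)
  from * show "vholomorphic_on (\<lambda>z. A (f z)) U"
    using assms(3) by (auto simp: vholomorphic_on_open)
  from * show "z \<in> U \<Longrightarrow> vderiv (\<lambda>z. A (f z)) z = A (vderiv f z)"
    by (rule vderiv_eq)
qed

lemma vholomorphic_on_scaleC:
  assumes "\<phi> holomorphic_on U" "vholomorphic_on f U" "open U"
  shows "vholomorphic_on (\<lambda>z. \<phi> z *\<^sub>C f z) U"
    and "z \<in> U \<Longrightarrow> vderiv (\<lambda>z. \<phi> z *\<^sub>C f z) z = deriv \<phi> z *\<^sub>C f z + \<phi> z *\<^sub>C vderiv f z"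
proof -
  have *: "((\<lambda>z. \<phi> z *\<^sub>C f z) has_derivative
      (\<lambda>h. h *\<^sub>C (deriv \<phi> z *\<^sub>C f z + \<phi> z *\<^sub>C vderiv f z))) (at z)" if "z \<in> U" for z
  proof -
    have "(\<phi> has_derivative (\<lambda>h. deriv \<phi> z * h)) (at z)"
      using holomorphic_derivI[OF assms(1,3) that] by (simp add: has_field_derivative_def)
    from has_derivative_scaleC[OF this has_derivative_vderiv[OF assms(2,3) that]]
    show ?thesis
      by (simp add: scaleC_add_right scaleC_scaleC algebra_simps)
  qed
  from * show "vholomorphic_on (\<lambda>z. \<phi> z *\<^sub>C f z) U"
    using assms(3) by (auto simp: vholomorphic_on_open)
  from * show "z \<in> U \<Longrightarrow> vderiv (\<lambda>z. \<phi> z *\<^sub>C f z) z = deriv \<phi> z *\<^sub>C f z + \<phi> z *\<^sub>C vderiv f z"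
    by (rule vderiv_eq)
qed

lemma vholomorphic_on_cinner:
  assumes "vholomorphic_on f U" "open U"
  shows "(\<lambda>w. cinner (f w) x) holomorphic_on U"
    and "z \<in> U \<Longrightarrow> deriv (\<lambda>w. cinner (f w) x) z = cinner (vderiv f z) x"
proof -
  have *: "((\<lambda>w. cinner (f w) x) has_field_derivative cinner (vderiv f z) x) (at z)" if "z \<in> U" for z
    using bounded_linear.has_derivative[OF bounded_linear_cinner_left has_derivative_vderiv[OF assms that]]
    by (simp add: has_field_derivative_def cinner_scaleC_left mult_commute_abs)
  then show "(\<lambda>w. cinner (f w) x) holomorphic_on U"
    using assms(2) by (auto simp: holomorphic_on_open)
  show "z \<in> U \<Longrightarrow> deriv (\<lambda>w. cinner (f w) x) z = cinner (vderiv f z) x"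
    using * by (rule DERIV_imp_deriv)
qed

text \<open>First-order Taylor expansion of \<open>deriv f\<close>, whose remainder is governed by
  the third derivative of \<open>f\<close>; Cauchy's inequality on discs of radius \<open>r\<close>
  bounds that by \<open>3! * M / r ^ 3\<close>. The constant is linear in \<open>M\<close>, which
  later gives uniformity over scalar functions bounded by \<open>M * norm x\<close>.\<close>

lemma deriv_Taylor_bound:
  assumes "f holomorphic_on U" "open U" "cball z (2 * r) \<subseteq> U" "0 < r"
    and "\<And>w. w \<in> cball z (2 * r) \<Longrightarrow> cmod (f w) \<le> M" and "cmod h < r"
  shows "cmod (deriv f (z + h) - deriv f z - deriv (deriv f) z * h) \<le> 6 * M / r ^ 3 * (cmod h)\<^sup>2"
proof -
  \<comment> \<open>Shifted by one so that the expansion starts at \<open>deriv f\<close>: thus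
    \<open>F (Suc 1)\<close> is the third derivative of \<open>f\<close>.\<close>
  define F where "F i = (deriv ^^ Suc i) f" for i
  have sub: "cball u r \<subseteq> cball z (2 * r)" if "u \<in> ball z r" for u
    using that by (auto simp: cball_subset_cball_iff dist_commute)
  have bound: "cmod (F (Suc 1) u) \<le> 6 * M / r ^ 3" if u: "u \<in> ball z r" for u
  proof -
    have "cmod ((deriv ^^ 3) f u) \<le> fact 3 * M / r ^ 3"
    proof (rule Cauchy_inequality)
      show "f holomorphic_on ball u r"
        using assms(1,3) sub[OF u] ball_subset_cball by (metis holomorphic_on_subset order_trans)
      show "continuous_on (cball u r) f"
        using assms(1,3) sub[OF u] by (metis holomorphic_on_imp_continuous_on holomorphic_on_subset order_trans)
      show "cmod (f x) \<le> M" if "norm (u - x) = r" for x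
        using that sub[OF u] assms(5) by (force simp: dist_norm)
    qed fact
    then show ?thesis
      by (simp add: F_def numeral_3_eq_3 fact_numeral)
  qed
  have "cmod (F 0 (z + h) - (\<Sum>i\<le>1. F i z * (z + h - z) ^ i / fact i))
      \<le> 6 * M / r ^ 3 * cmod (z + h - z) ^ Suc 1 / fact 1"
  proof (rule complex_Taylor[where S = "ball z r"])
    show "(F i has_field_derivative F (Suc i) x) (at x within ball z r)" if "x \<in> ball z r" for i x
    proof -
      have "x \<in> U"
        using that assms(3,4) by (auto simp: subset_iff)
      then show ?thesis
        unfolding F_def using has_field_derivative_higher_deriv[OF assms(1,2), of x "Suc i"]
        by (simp add: has_field_derivative_at_within)
    qed
  qed (use bound assms in \<open>auto simp: dist_norm\<close>)
  then show ?thesis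
    by (simp add: F_def power2_eq_square diff_diff_eq mult.commute)
qed

text \<open>The Taylor bounds for the scalar functions \<open>w \<mapsto> cinner (f w) x\<close> are uniform in the unit ball of
  \<open>x\<close>, so the difference quotients of the derivative form a Cauchy sequence in norm.\<close>

theorem vholomorphic_on_vderiv:
  fixes f :: "complex \<Rightarrow> 'a::{complex_inner, complete_space}"
  assumes f: "vholomorphic_on f U" and U: "open U"
  shows "vholomorphic_on (vderiv f) U"
proof -
  have "\<exists>v. (vderiv f has_derivative (\<lambda>h. h *\<^sub>C v)) (at z)" if z: "z \<in> U" for z
  proof -
    obtain R where R: "R > 0" "cball z R \<subseteq> U"
      using U z open_contains_cball by blast
    define r where "r = R / 2"
    have r: "r > 0" "cball z (2 * r) \<subseteq> U"
      using R by (auto simp: r_def)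
    have "bounded (f ` cball z (2 * r))"
      using vholomorphic_on_continuous_on[OF f U] r(2) continuous_on_subset
      by (intro compact_imp_bounded compact_continuous_image) auto
    then obtain M where M: "\<And>w. w \<in> cball z (2 * r) \<Longrightarrow> norm (f w) \<le> M"
      unfolding bounded_iff by blast
    define K where "K = 6 * M / r ^ 3"
    define g where "g = vderiv f"
    define Q where "Q h = (1 / h) *\<^sub>C (g (z + h) - g z)" for h
    have scalar: "cmod (cinner (g (z + h) - g z) x - deriv (deriv (\<lambda>w. cinner (f w) x)) z * h)
        \<le> K * norm x * (cmod h)\<^sup>2" if h: "cmod h < r" for h x
    proof -
      have "cmod (deriv (\<lambda>w. cinner (f w) x) (z + h) - deriv (\<lambda>w. cinner (f w) x) z
          - deriv (deriv (\<lambda>w. cinner (f w) x)) z * h) \<le> 6 * (M * norm x) / r ^ 3 * (cmod h)\<^sup>2"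
      proof (rule deriv_Taylor_bound[OF _ U r(2,1) _ h])
        show "(\<lambda>w. cinner (f w) x) holomorphic_on U"
          by (rule vholomorphic_on_cinner[OF f U])
        show "cmod (cinner (f w) x) \<le> M * norm x" if "w \<in> cball z (2 * r)" for w
          using norm_cinner_le[of "f w" x] M[OF that] by (meson mult_right_mono norm_ge_zero order_trans)
      qed
      moreover have "z + h \<in> U"
        using h r by (auto simp: subset_iff dist_norm)
      ultimately show ?thesis
        by (simp add: vholomorphic_on_cinner(2)[OF f U] z cinner_diff_left g_def K_def mult_ac)
    qed
    have quot: "cmod (cinner (Q h) x - deriv (deriv (\<lambda>w. cinner (f w) x)) z) \<le> K * norm x * cmod h"
      if "cmod h < r" "h \<noteq> 0" for h x
    proof -
      have "cinner (Q h) x - deriv (deriv (\<lambda>w. cinner (f w) x)) z =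
          (cinner (g (z + h) - g z) x - deriv (deriv (\<lambda>w. cinner (f w) x)) z * h) / h"
        using that(2) by (simp add: Q_def cinner_scaleC_left diff_divide_distrib)
      then show ?thesis
        using scalar[OF that(1), of x] that(2)
        by (simp add: norm_divide divide_le_eq power2_eq_square mult_ac)
    qed
    have lip: "norm (Q h - Q k) \<le> K * (cmod h + cmod k)"
      if "cmod h < r" "h \<noteq> 0" "cmod k < r" "k \<noteq> 0" for h k
    proof (cases "Q h - Q k = 0")
      case True
      have "0 \<le> M"
        using order_trans[OF norm_ge_zero M[of z]] r(1) by simp
      then show ?thesis
        using True r by (simp add: K_def)
    next
      case False
      \<comment> \<open>Testing the weak estimates against the difference itself turns them into a
        norm estimate, since \<open>cinner x x\<close> is the squared norm and one factor
        \<open>norm x\<close> cancels.\<close>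
      define x where "x = Q h - Q k"
      have "(norm x)\<^sup>2 = cmod (cinner (Q h) x - cinner (Q k) x)"
        unfolding cinner_diff_left[symmetric] x_def[symmetric] cinner_self
        by (simp add: norm_power)
      also have "\<dots> \<le> K * norm x * cmod h + K * norm x * cmod k"
        using quot[OF that(1,2), of x] quot[OF that(3,4), of x]
        by (smt (verit) norm_triangle_ineq4 diff_diff_eq2 diff_add_cancel)
      also have "\<dots> = norm x * (K * (cmod h + cmod k))"
        by (simp add: algebra_simps)
      finally show ?thesis
        using False by (simp add: power2_eq_square x_def)
    qed
    \<comment> \<open>A null sequence of admissible increments; the second \<open>Suc\<close> keeps
      even the first one strictly below \<open>r\<close>.\<close>
    define s where "s n = complex_of_real (r * inverse (real (Suc (Suc n))))" for n
    have s: "cmod (s n) < r" "s n \<noteq> 0" for n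
    proof -
      have "inverse (real (Suc (Suc n))) < 1"
        by (simp add: field_simps)
      then have "r * inverse (real (Suc (Suc n))) < r * 1"
        using r(1) by (rule mult_strict_left_mono)
      then show "cmod (s n) < r"
        using r(1) unfolding s_def norm_of_real by simp
      show "s n \<noteq> 0"
        using r(1) by (simp add: s_def del: of_nat_Suc)
    qed
    have s0: "(\<lambda>n. cmod (s n)) \<longlonglongrightarrow> 0"
    proof -
      have "(\<lambda>n. r * inverse (real (Suc (Suc n)))) \<longlonglongrightarrow> r * 0"
        using LIMSEQ_Suc[OF LIMSEQ_inverse_real_of_nat] by (intro tendsto_intros)
      then show ?thesis
        using r(1) unfolding s_def norm_of_real by simp
    qed
    have "Cauchy (\<lambda>n. Q (s n))"
    proof (rule metric_CauchyI)
      fix e :: real assume "e > 0"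
      have "(\<lambda>n. K * cmod (s n)) \<longlonglongrightarrow> 0"
        using tendsto_mult_right_zero[OF s0] .
      then have "eventually (\<lambda>n. K * cmod (s n) < e / 2) sequentially"
        by (rule order_tendstoD) (use \<open>e > 0\<close> in simp)
      then obtain N where N: "\<And>n. n \<ge> N \<Longrightarrow> K * cmod (s n) < e / 2"
        by (auto simp: eventually_sequentially)
      have "dist (Q (s m)) (Q (s n)) < e" if "m \<ge> N" "n \<ge> N" for m n
        using lip[OF s s, of m n] N[OF that(1)] N[OF that(2)] by (simp add: dist_norm algebra_simps)
      then show "\<exists>N. \<forall>m\<ge>N. \<forall>n\<ge>N. dist (Q (s m)) (Q (s n)) < e"
        by blast
    qed
    then obtain L where L: "(\<lambda>n. Q (s n)) \<longlonglongrightarrow> L"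
      by (auto simp: Cauchy_convergent_iff convergent_def)
    have QL: "norm (Q h - L) \<le> K * cmod h" if "cmod h < r" "h \<noteq> 0" for h
    proof (rule LIMSEQ_le)
      show "(\<lambda>n. norm (Q h - Q (s n))) \<longlonglongrightarrow> norm (Q h - L)"
        by (intro tendsto_intros L)
      show "(\<lambda>n. K * (cmod h + cmod (s n))) \<longlonglongrightarrow> K * cmod h"
        using tendsto_mult[OF tendsto_const tendsto_add[OF tendsto_const s0], of K "cmod h"] by simp
    qed (use lip[OF that s] in blast)
    have rem: "norm (g y - g z - (y - z) *\<^sub>C L) \<le> K * cmod (y - z) * cmod (y - z)"
      if "cmod (y - z) < r" for y
    proof (cases "y = z")
      case False
      then have "g y - g z - (y - z) *\<^sub>C L = (y - z) *\<^sub>C (Q (y - z) - L)"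
        by (simp add: Q_def scaleC_diff_right scaleC_scaleC scaleC_one)
      then show ?thesis
        using QL[of "y - z"] that False by (simp add: mult.commute mult_left_mono)
    qed simp
    have "(g has_derivative (\<lambda>h. h *\<^sub>C L)) (at z)"
      unfolding has_derivative_at_alt
    proof (intro conjI allI impI)
      show "bounded_linear (\<lambda>h. h *\<^sub>C L)"
        by (rule bounded_bilinear.bounded_linear_left[OF bounded_bilinear_scaleC])
      fix e :: real assume "e > 0"
      define d where "d = min r (e / (\<bar>K\<bar> + 1))"
      have "norm (g y - g z - (y - z) *\<^sub>C L) \<le> e * norm (y - z)" if y: "norm (y - z) < d" for y
      proof -
        have "K * cmod (y - z) \<le> (\<bar>K\<bar> + 1) * cmod (y - z)"
          by (intro mult_right_mono) auto
        also have "\<dots> \<le> e"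
          using y by (simp add: d_def less_divide_eq mult.commute split: if_splits)
        finally have "K * cmod (y - z) * cmod (y - z) \<le> e * cmod (y - z)"
          by (rule mult_right_mono) simp
        then show ?thesis
          using rem[of y] y by (simp add: d_def)
      qed
      moreover have "d > 0"
        using r \<open>e > 0\<close> by (simp add: d_def)
      ultimately show "\<exists>d>0. \<forall>y. norm (y - z) < d \<longrightarrow> norm (g y - g z - (y - z) *\<^sub>C L) \<le> e * norm (y - z)"
        by blast
    qed
    then show ?thesis
      unfolding g_def by blast
  qed
  then show ?thesis
    using U by (simp add: vholomorphic_on_open)
qed

section \<open>Curvature and polarization\<close>

text \<open>For holomorphic \<open>f\<close> without zeros this is the Wirtinger derivative in
  \<open>z\<close> of \<open>ln ((norm (f z))\<^sup>2)\<close>: the term from the second slot is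
  conjugate-linear in the increment and does not contribute.\<close>

definition log_derivative :: "(complex \<Rightarrow> 'a::complex_inner) \<Rightarrow> complex \<Rightarrow> complex" where
  "log_derivative f w = cinner (vderiv f w) (f w) / cinner (f w) (f w)"

lemma partial_eq:
  assumes "(f has_derivative D) (at z)"
  shows "partial_x f z = D 1" and "partial_y f z = D \<i>"
proof -
  have dir: "((\<lambda>t::real. f (z + k * of_real t)) has_vector_derivative D k) (at 0)" for k
  proof -
    have "((\<lambda>t::real. z + k * of_real t) has_derivative (\<lambda>t. k * of_real t)) (at 0)"
      by (auto intro!: derivative_eq_intros)
    moreover have "(f has_derivative D) (at (z + k * of_real 0))"
      using assms by simp
    ultimately have "((f \<circ> (\<lambda>t::real. z + k * of_real t)) has_derivative D \<circ> (\<lambda>t. k * of_real t)) (at 0)"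
      by (rule diff_chain_at)
    moreover have "D (k * of_real t) = t *\<^sub>R D k" for t
    proof -
      have "k * of_real t = t *\<^sub>R k"
        by (simp add: scaleR_conv_of_real mult.commute)
      then show ?thesis
        using linear_scale[OF has_derivative_linear[OF assms]] by simp
    qed
    ultimately show ?thesis
      by (simp add: has_vector_derivative_def o_def)
  qed
  show "partial_x f z = D 1"
    unfolding partial_x_def using vector_derivative_at[OF dir[of 1]] by simp
  show "partial_y f z = D \<i>"
    unfolding partial_y_def using vector_derivative_at[OF dir[of \<i>]] by simp
qed

lemma has_derivative_ln_norm_square:
  assumes "vholomorphic_on f U" "open U" "z \<in> U" "f z \<noteq> 0"
  shows "((\<lambda>w. ln ((norm (f w))\<^sup>2)) has_derivative (\<lambda>h. 2 * Re (h * log_derivative f z))) (at z)"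
proof -
  note f = has_derivative_vderiv[OF assms(1-3)]
  have "((\<lambda>w. inner (f w) (f w)) has_derivative
      (\<lambda>h. inner (f z) (h *\<^sub>C vderiv f z) + inner (h *\<^sub>C vderiv f z) (f z))) (at z)"
    by (rule has_derivative_inner[OF f f])
  from has_derivative_ln[OF _ this] assms(4)
  have "((\<lambda>w. ln (inner (f w) (f w))) has_derivative
      (\<lambda>h. (inner (f z) (h *\<^sub>C vderiv f z) + inner (h *\<^sub>C vderiv f z) (f z)) * inverse (inner (f z) (f z)))) (at z)"
    by (simp add: mult.commute)
  moreover have "(inner (f z) (h *\<^sub>C vderiv f z) + inner (h *\<^sub>C vderiv f z) (f z)) * inverse (inner (f z) (f z))
      = 2 * Re (h * log_derivative f z)" for h
  proof -
    have "h * log_derivative f z = (h * cinner (vderiv f z) (f z)) / complex_of_real ((norm (f z))\<^sup>2)"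
      by (simp add: log_derivative_def cinner_self)
    then have "Re (h * log_derivative f z) = Re (h * cinner (vderiv f z) (f z)) / (norm (f z))\<^sup>2"
      by (simp only: Re_divide_of_real)
    moreover have "inner (h *\<^sub>C vderiv f z) (f z) = Re (h * cinner (vderiv f z) (f z))"
      by (simp add: inner_eq_Re_cinner cinner_scaleC_left)
    moreover have "inner (f z) (h *\<^sub>C vderiv f z) = inner (h *\<^sub>C vderiv f z) (f z)"
      by (rule inner_commute)
    ultimately show ?thesis
      by (simp add: power2_norm_eq_inner divide_inverse)
  qed
  ultimately show ?thesis
    by (simp add: power2_norm_eq_inner)
qed

text \<open>Curvature involves two derivatives of the norm, so \<open>vderiv f\<close> must itself
  be differentiable; \<open>vholomorphic_on_vderiv\<close> supplies this.\<close>

lemma log_derivative_differentiable: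
  fixes f :: "complex \<Rightarrow> 'a::{complex_inner, complete_space}"
  assumes "vholomorphic_on f U" "open U" "z \<in> U" "f z \<noteq> 0"
  obtains D where "(log_derivative f has_derivative D) (at z)"
proof -
  note f = has_derivative_vderiv[OF assms(1-3)]
  note f' = has_derivative_vderiv[OF vholomorphic_on_vderiv[OF assms(1,2)] assms(2,3)]
  have "cinner (f z) (f z) \<noteq> 0"
    using assms(4) by simp
  from has_derivative_divide'[OF has_derivative_cinner[OF f' f] has_derivative_cinner[OF f f] this]
  show ?thesis
    using that unfolding log_derivative_def by blast
qed

text \<open>The logarithm of the norm is real, so its derivative in the conjugate variable is the
  conjugate of \<open>log_derivative f\<close>. Conjugation also swaps the outer derivative, leaving
  the conjugate of \<open>(D 1 + \<i> * D \<i>) / 2\<close>, the antiholomorphic derivative of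
  \<open>log_derivative f\<close>.\<close>

lemma section_curvature_eq:
  assumes "vholomorphic_on f U" "open U" "z \<in> U" "\<And>w. w \<in> U \<Longrightarrow> f w \<noteq> 0"
    and D: "(log_derivative f has_derivative D) (at z)"
  shows "section_curvature f z = - cnj (D 1 + \<i> * D \<i>) / 2"
proof -
  let ?u = "\<lambda>w. complex_of_real (ln ((norm (f w))\<^sup>2))"
  have bar: "wirtinger_bar ?u w = cnj (log_derivative f w)" if "w \<in> U" for w
  proof -
    have "(?u has_derivative (\<lambda>h. complex_of_real (2 * Re (h * log_derivative f w)))) (at w)"
      using bounded_linear.has_derivative[OF bounded_linear_of_real
          has_derivative_ln_norm_square[OF assms(1,2) that assms(4)[OF that]]] .
    from partial_eq[OF this] show ?thesis
      by (simp add: wirtinger_bar_def complex_eq_iff)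
  qed
  have "((\<lambda>w. cnj (log_derivative f w)) has_derivative (\<lambda>h. cnj (D h))) (at z)"
    by (rule bounded_linear.has_derivative[OF bounded_linear_cnj D])
  then have "(wirtinger_bar ?u has_derivative (\<lambda>h. cnj (D h))) (at z)"
    by (rule has_derivative_transform_within_open[OF _ assms(2,3)]) (simp add: bar)
  from partial_eq[OF this] show ?thesis
    by (simp add: section_curvature_def wirtinger_def field_simps)
qed

lemma log_derivative_cong:
  assumes "vholomorphic_on f U" "open U" "\<And>w. w \<in> U \<Longrightarrow> f w = g w" "z \<in> U"
  shows "log_derivative f z = log_derivative g z"
proof -
  have "(g has_derivative (\<lambda>h. h *\<^sub>C vderiv f z)) (at z)"
    using has_derivative_transform_within_open[OF has_derivative_vderiv[OF assms(1,2,4)] assms(2,4)] assms(3)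
    by blast
  then show ?thesis
    using vderiv_eq assms(3,4) by (fastforce simp: log_derivative_def)
qed

lemma vholomorphic_on_cong:
  assumes "vholomorphic_on f U" "open U" "\<And>w. w \<in> U \<Longrightarrow> f w = g w"
  shows "vholomorphic_on g U"
  unfolding vholomorphic_on_open[OF assms(2)]
  using has_derivative_transform_within_open[OF has_derivative_vderiv[OF assms(1,2)] assms(2)] assms(3)
  by blast

lemma log_derivative_scaleC:
  assumes "\<phi> holomorphic_on U" "vholomorphic_on f U" "open U" "z \<in> U" "\<phi> z \<noteq> 0" "f z \<noteq> 0"
  shows "log_derivative (\<lambda>w. \<phi> w *\<^sub>C f w) z = deriv \<phi> z / \<phi> z + log_derivative f z"
proof -
  have "cinner (f z) (f z) \<noteq> 0"
    using assms by simp
  then show ?thesis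
    using assms(5)
    by (simp add: log_derivative_def vholomorphic_on_scaleC(2)[OF assms(1-4)] cinner_add_left
        cinner_scaleC_left cinner_scaleC_right field_simps)
qed

text \<open>A holomorphic factor adds \<open>deriv \<phi> w / \<phi> w\<close> to the logarithmic
  derivative; this is holomorphic, hence invisible to the antiholomorphic derivative that computes
  the curvature.\<close>

lemma section_curvature_proportional:
  fixes f g :: "complex \<Rightarrow> 'a::{complex_inner, complete_space}"
  assumes "\<phi> holomorphic_on U" "vholomorphic_on f U" "open U" "z \<in> U"
    and nz: "\<And>w. w \<in> U \<Longrightarrow> \<phi> w \<noteq> 0" "\<And>w. w \<in> U \<Longrightarrow> f w \<noteq> 0"
    and g: "\<And>w. w \<in> U \<Longrightarrow> g w = \<phi> w *\<^sub>C f w"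
  shows "section_curvature g z = section_curvature f z"
proof -
  have g_hol: "vholomorphic_on g U"
    by (rule vholomorphic_on_cong[OF vholomorphic_on_scaleC(1)[OF assms(1-3)] assms(3)]) (simp add: g)
  obtain D where D: "(log_derivative f has_derivative D) (at z)"
    using log_derivative_differentiable[OF assms(2-4) nz(2)[OF assms(4)]] .
  have "(\<lambda>w. deriv \<phi> w / \<phi> w) holomorphic_on U"
    using assms(1,3) nz by (intro holomorphic_intros) auto
  then obtain c where "((\<lambda>w. deriv \<phi> w / \<phi> w) has_field_derivative c) (at z)"
    using assms(3,4) by (auto simp: holomorphic_on_open)
  then have "((\<lambda>w. deriv \<phi> w / \<phi> w + log_derivative f w) has_derivative (\<lambda>h. c * h + D h)) (at z)"
    unfolding has_field_derivative_def by (rule has_derivative_add[OF _ D])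
  then have g': "(log_derivative g has_derivative (\<lambda>h. c * h + D h)) (at z)"
  proof (rule has_derivative_transform_within_open[OF _ assms(3,4)])
    fix w assume w: "w \<in> U"
    have "log_derivative g w = log_derivative (\<lambda>w. \<phi> w *\<^sub>C f w) w"
      by (rule log_derivative_cong[OF g_hol assms(3) g w])
    then show "deriv \<phi> w / \<phi> w + log_derivative f w = log_derivative g w"
      using log_derivative_scaleC[OF assms(1-3) w nz(1)[OF w] nz(2)[OF w]] by simp
  qed
  \<comment> \<open>The complex-linear summand \<open>c * h\<close> cancels because
    \<open>\<i> * (c * \<i>) = - c\<close>.\<close>
  have c: "c + D 1 + \<i> * (c * \<i> + D \<i>) = D 1 + \<i> * D \<i>"
    by (simp add: algebra_simps)
  have "g w \<noteq> 0" if "w \<in> U" for w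
    using that nz g by simp
  from section_curvature_eq[OF g_hol assms(3,4) this g'] section_curvature_eq[OF assms(2-4) nz(2) D]
  show ?thesis
    by (simp only: c mult_1_right)
qed

text \<open>Equal curvature means that the difference \<open>q\<close> of the logarithmic
  derivatives satisfies the Cauchy-Riemann equations. A primitive \<open>F\<close> of
  \<open>q\<close> exists on the disc, and twice its real part equals the difference of the
  logarithms of the squared norms up to a constant. Exponentiating gives \<psi>.\<close>

lemma equal_section_curvature:
  fixes f :: "complex \<Rightarrow> 'a::{complex_inner, complete_space}"
    and g :: "complex \<Rightarrow> 'b::{complex_inner, complete_space}"
  assumes f: "vholomorphic_on f (ball a r)" "\<And>w. w \<in> ball a r \<Longrightarrow> f w \<noteq> 0"
    and g: "vholomorphic_on g (ball a r)" "\<And>w. w \<in> ball a r \<Longrightarrow> g w \<noteq> 0"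
    and eq: "\<And>w. w \<in> ball a r \<Longrightarrow> section_curvature f w = section_curvature g w"
  obtains \<psi> where "\<psi> holomorphic_on ball a r" "\<And>w. w \<in> ball a r \<Longrightarrow> \<psi> w \<noteq> 0"
    "\<And>w. w \<in> ball a r \<Longrightarrow> norm (f w) = cmod (\<psi> w) * norm (g w)"
proof -
  define q where "q w = log_derivative f w - log_derivative g w" for w
  have "\<exists>c. (q has_field_derivative c) (at z)" if z: "z \<in> ball a r" for z
  proof -
    obtain D where D: "(log_derivative f has_derivative D) (at z)"
      using log_derivative_differentiable[OF f(1) open_ball z f(2)[OF z]] .
    obtain E where E: "(log_derivative g has_derivative E) (at z)"
      using log_derivative_differentiable[OF g(1) open_ball z g(2)[OF z]] .
    define L where "L h = D h - E h" for h
    define l where "l = L 1"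
    have q: "(q has_derivative L) (at z)"
      unfolding q_def L_def by (rule has_derivative_diff[OF D E])
    have inj: "x = y" if "- cnj x / 2 = - cnj y / 2" for x y
      using that by simp
    have "- cnj (D 1 + \<i> * D \<i>) / 2 = - cnj (E 1 + \<i> * E \<i>) / 2"
      using eq[OF z] section_curvature_eq[OF f(1) open_ball z f(2) D]
        section_curvature_eq[OF g(1) open_ball z g(2) E] by (simp only:)
    then have "D 1 + \<i> * D \<i> = E 1 + \<i> * E \<i>"
      by (rule inj)
    then have "L 1 + \<i> * L \<i> = 0"
      by (simp add: L_def algebra_simps)
    \<comment> \<open>Multiplication by \<open>\<i>\<close> brings the Cauchy-Riemann equation into
      the form \<open>L \<i> = \<i> * L 1\<close>, that is, complex linearity of the real-linear
      \<open>L\<close>.\<close>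
    then have "\<i> * (L 1 + \<i> * L \<i>) = 0"
      by simp
    then have L_i: "L \<i> = \<i> * L 1"
      by (simp add: distrib_left mult.assoc[symmetric])
    have L_real: "L h = Re h *\<^sub>R L 1 + Im h *\<^sub>R L \<i>" for h
    proof -
      have "h = Re h *\<^sub>R 1 + Im h *\<^sub>R \<i>"
        by (simp add: complex_eq_iff)
      then have "L h = L (Re h *\<^sub>R 1 + Im h *\<^sub>R \<i>)"
        by simp
      then show ?thesis
        using has_derivative_linear[OF q] by (simp only: linear_add linear_scale)
    qed
    have "L h = l * h" for h
    proof -
      have "L h = (of_real (Re h) + \<i> * of_real (Im h)) * l"
        unfolding L_real[of h] L_i by (simp add: l_def scaleR_conv_of_real algebra_simps)
      also have "of_real (Re h) + \<i> * of_real (Im h) = h"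
        by (simp add: complex_eq_iff)
      finally show ?thesis
        by (simp add: mult.commute)
    qed
    then have "L = (*) l"
      by (rule ext)
    then have "(q has_derivative (*) l) (at z)"
      using q by simp
    then show ?thesis
      by (auto simp: has_field_derivative_def)
  qed
  then have "q holomorphic_on ball a r"
    by (simp add: holomorphic_on_open)
  then obtain F where F: "\<And>w. w \<in> ball a r \<Longrightarrow> (F has_field_derivative q w) (at w within ball a r)"
    using holomorphic_convex_primitive'[OF convex_ball open_ball] by metis
  define u where "u w = ln ((norm (f w))\<^sup>2) - ln ((norm (g w))\<^sup>2) - 2 * Re (F w)" for w
  have "(u has_derivative (\<lambda>h. 0)) (at w within ball a r)" if w: "w \<in> ball a r" for w
  proof -
    have "(F has_derivative (\<lambda>h. q w * h)) (at w within ball a r)"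
      using F[OF w] by (simp add: has_field_derivative_def)
    then have "((\<lambda>w. 2 * Re (F w)) has_derivative (\<lambda>h. 2 * Re (q w * h))) (at w within ball a r)"
      by (intro has_derivative_mult_right bounded_linear.has_derivative[OF bounded_linear_Re])
    moreover note has_derivative_at_withinI[OF has_derivative_ln_norm_square[OF f(1) open_ball w f(2)[OF w]], of "ball a r"]
      has_derivative_at_withinI[OF has_derivative_ln_norm_square[OF g(1) open_ball w g(2)[OF w]], of "ball a r"]
    ultimately have "(u has_derivative (\<lambda>h. 2 * Re (h * log_derivative f w) - 2 * Re (h * log_derivative g w)
        - 2 * Re (q w * h))) (at w within ball a r)"
      unfolding u_def by (rule has_derivative_diff[OF has_derivative_diff, rotated 2])
    then show ?thesis
      by (simp add: q_def algebra_simps)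
  qed
  then obtain c where c: "\<And>w. w \<in> ball a r \<Longrightarrow> u w = c"
    using has_derivative_zero_constant[OF convex_ball] by metis
  \<comment> \<open>The constant \<open>c\<close> compares logarithms of squared norms, so half of
    it belongs to the norms themselves.\<close>
  define \<psi> where "\<psi> w = exp (F w + of_real (c / 2))" for w
  show ?thesis
  proof (rule that)
    have "F holomorphic_on ball a r"
      unfolding holomorphic_on_def field_differentiable_def using F by blast
    then show "\<psi> holomorphic_on ball a r"
      unfolding \<psi>_def by (intro holomorphic_intros)
    fix w assume w: "w \<in> ball a r"
    show "\<psi> w \<noteq> 0"
      by (simp add: \<psi>_def)
    have "2 * ln (norm (f w)) = 2 * ln (norm (g w)) + 2 * Re (F w) + c"
      using c[OF w] f(2)[OF w] g(2)[OF w] by (simp add: u_def ln_realpow)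
    then have "ln (norm (f w)) = (Re (F w) + c / 2) + ln (norm (g w))"
      by simp
    then have "exp (ln (norm (f w))) = exp (Re (F w) + c / 2) * exp (ln (norm (g w)))"
      by (simp only: exp_add)
    then show "norm (f w) = cmod (\<psi> w) * norm (g w)"
      using f(2)[OF w] g(2)[OF w] by (simp add: \<psi>_def)
  qed
qed

text \<open>\<open>cinner\<close> is conjugate-linear in its second argument, which undoes the
  \<open>cnj\<close> applied to \<open>s\<close> there. The two conjugations compose to a genuine
  complex derivative in \<open>s\<close>.\<close>

lemma polarized_has_derivative:
  assumes "vholomorphic_on f U" "open U" "\<alpha> + k * s \<in> U" "\<beta> + m * cnj s \<in> U"
  shows "\<exists>d. ((\<lambda>s. cinner (f (\<alpha> + k * s)) (f (\<beta> + m * cnj s))) has_field_derivative d) (at s)"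
proof -
  have 1: "((\<lambda>s. f (\<alpha> + k * s)) has_derivative (\<lambda>h. (k * h) *\<^sub>C vderiv f (\<alpha> + k * s))) (at s)"
  proof (rule has_derivative_compose[where g = f and f = "\<lambda>s. \<alpha> + k * s" and x = s,
        OF _ has_derivative_vderiv[OF assms(1,2,3)]])
    show "((\<lambda>s. \<alpha> + k * s) has_derivative (*) k) (at s)"
      by (auto intro!: derivative_eq_intros)
  qed
  have 2: "((\<lambda>s. f (\<beta> + m * cnj s)) has_derivative (\<lambda>h. (m * cnj h) *\<^sub>C vderiv f (\<beta> + m * cnj s))) (at s)"
  proof (rule has_derivative_compose[where g = f and f = "\<lambda>s. \<beta> + m * cnj s" and x = s,
        OF _ has_derivative_vderiv[OF assms(1,2,4)]])
    show "((\<lambda>s. \<beta> + m * cnj s) has_derivative (\<lambda>h. m * cnj h)) (at s)"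
      using has_derivative_add[OF has_derivative_const[of \<beta>] has_derivative_mult_right[OF
            bounded_linear_imp_has_derivative[OF bounded_linear_cnj]]] by simp
  qed
  let ?d = "k * cinner (vderiv f (\<alpha> + k * s)) (f (\<beta> + m * cnj s)) +
    cnj m * cinner (f (\<alpha> + k * s)) (vderiv f (\<beta> + m * cnj s))"
  have "((\<lambda>s. cinner (f (\<alpha> + k * s)) (f (\<beta> + m * cnj s))) has_derivative (\<lambda>h. ?d * h)) (at s)"
    using has_derivative_cinner[OF 1 2]
    by (simp add: cinner_scaleC_left cinner_scaleC_right algebra_simps)
  then show ?thesis
    by (auto simp: has_field_derivative_def)
qed

lemma holomorphic_eq_0_on_reals:
  assumes "h holomorphic_on ball 0 \<rho>" "\<And>x::real. \<bar>x\<bar> < \<rho> \<Longrightarrow> h (of_real x) = 0" "s \<in> ball 0 \<rho>"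
  shows "h s = 0"
proof -
  have \<rho>: "\<rho> > 0"
    using assms(3) norm_ge_zero[of s] by (simp del: norm_ge_zero)
  let ?R = "complex_of_real ` {x. \<bar>x\<bar> < \<rho>}"
  have "0 islimpt ?R"
    unfolding islimpt_approachable
  proof (intro allI impI)
    fix e :: real assume "e > 0"
    then show "\<exists>x'\<in>?R. x' \<noteq> 0 \<and> dist x' 0 < e"
      using \<rho> by (intro bexI[of _ "complex_of_real (min (\<rho> / 2) (e / 2))"]) (auto simp: min_def)
  qed
  then show ?thesis
    using assms \<rho> by (intro analytic_continuation[of h "ball 0 \<rho>" ?R 0 s]) auto
qed

text \<open>With \<open>w = a + s + \<i> t\<close> and \<open>v = a + cnj s + \<i> cnj t\<close> the difference of the two sides is holomorphic
  in \<open>s\<close> and in \<open>t\<close>, and the diagonal \<open>w = v\<close> corresponds to real \<open>s\<close> and \<open>t\<close>.\<close>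

theorem cinner_eq_of_norm_eq:
  assumes f: "vholomorphic_on f (ball a r)" and g: "vholomorphic_on g (ball a r)"
    and norm_eq: "\<And>w. w \<in> ball a r \<Longrightarrow> norm (f w) = norm (g w)"
    and w: "w \<in> ball a (r / 2)" and v: "v \<in> ball a (r / 2)"
  shows "cinner (f w) (f v) = cinner (g w) (g v)"
proof -
  define H where "H s t = cinner (f (a + s + \<i> * t)) (f (a + cnj s + \<i> * cnj t))
    - cinner (g (a + s + \<i> * t)) (g (a + cnj s + \<i> * cnj t))" for s t
  have mem: "a + s + \<i> * t \<in> ball a r" "a + cnj s + \<i> * cnj t \<in> ball a r"
    if "s \<in> ball 0 (r / 2)" "t \<in> ball 0 (r / 2)" for s t
  proof -
    have "cmod (s + \<i> * t) < r" "cmod (cnj s + \<i> * cnj t) < r"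
      using that norm_triangle_ineq[of s "\<i> * t"] norm_triangle_ineq[of "cnj s" "\<i> * cnj t"]
      by (simp_all add: norm_mult)
    moreover have "dist a (a + x) = cmod x" for x
      by (simp add: dist_norm)
    ultimately show "a + s + \<i> * t \<in> ball a r" "a + cnj s + \<i> * cnj t \<in> ball a r"
      by (simp_all add: add.assoc)
  qed
  have hol_s: "(\<lambda>s. H s t) holomorphic_on ball 0 (r / 2)" if t: "t \<in> ball 0 (r / 2)" for t :: complex
    unfolding holomorphic_on_open[OF open_ball]
  proof
    fix s :: complex assume s: "s \<in> ball 0 (r / 2)"
    have "\<exists>d. ((\<lambda>s. cinner (f (a + \<i> * t + 1 * s)) (f (a + \<i> * cnj t + 1 * cnj s))) has_field_derivative d) (at s)"
      "\<exists>d. ((\<lambda>s. cinner (g (a + \<i> * t + 1 * s)) (g (a + \<i> * cnj t + 1 * cnj s))) has_field_derivative d) (at s)"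
      by (rule polarized_has_derivative[OF f open_ball] polarized_has_derivative[OF g open_ball];
          use mem[OF s t] in \<open>simp add: add_ac\<close>)+
    then show "\<exists>d. ((\<lambda>s. H s t) has_field_derivative d) (at s)"
      unfolding H_def by (auto simp: add_ac intro: DERIV_diff)
  qed
  have hol_t: "(\<lambda>t. H s t) holomorphic_on ball 0 (r / 2)" if s: "s \<in> ball 0 (r / 2)" for s :: complex
    unfolding holomorphic_on_open[OF open_ball]
  proof
    fix t :: complex assume t: "t \<in> ball 0 (r / 2)"
    have "\<exists>d. ((\<lambda>t. cinner (f (a + s + \<i> * t)) (f (a + cnj s + \<i> * cnj t))) has_field_derivative d) (at t)"
      "\<exists>d. ((\<lambda>t. cinner (g (a + s + \<i> * t)) (g (a + cnj s + \<i> * cnj t))) has_field_derivative d) (at t)"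
      by (rule polarized_has_derivative[OF f open_ball] polarized_has_derivative[OF g open_ball];
          use mem[OF s t] in simp)+
    then show "\<exists>d. ((\<lambda>t. H s t) has_field_derivative d) (at t)"
      unfolding H_def by (auto intro: DERIV_diff)
  qed
  have real: "H (of_real x) (of_real y) = 0" if "\<bar>x\<bar> < r / 2" "\<bar>y\<bar> < r / 2" for x y :: real
  proof -
    have "a + of_real x + \<i> * of_real y \<in> ball a r"
      using that by (intro mem) simp_all
    from norm_eq[OF this] show ?thesis
      by (simp add: H_def cinner_self)
  qed
  \<comment> \<open>The identity theorem in one variable is used twice: \<open>s\<close> becomes
    complex while \<open>t\<close> stays real, and afterwards \<open>t\<close> becomes complex for
    each such \<open>s\<close>.\<close>
  have zero_s: "H s (of_real y) = 0" if s: "s \<in> ball 0 (r / 2)" and y: "\<bar>y\<bar> < r / 2" for s and y :: real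
  proof (rule holomorphic_eq_0_on_reals[OF hol_s _ s])
    show "complex_of_real y \<in> ball 0 (r / 2)"
      using y by simp
  qed (rule real[OF _ y])
  have zero: "H s t = 0" if s: "s \<in> ball 0 (r / 2)" and t: "t \<in> ball 0 (r / 2)" for s t
    by (rule holomorphic_eq_0_on_reals[OF hol_t[OF s] zero_s[OF s] t])
  define p where "p = w - a"
  define q where "q = v - a"
  \<comment> \<open>These solve \<open>s + \<i> * t = p\<close> and
    \<open>s - \<i> * t = cnj q\<close>. Their moduli are at most the mean of those of
    \<open>p\<close> and \<open>q\<close>, hence below \<open>r / 2\<close>, as required for the
    arguments of \<open>f\<close> and \<open>g\<close> to stay in \<open>ball a r\<close>.\<close>
  define s where "s = (p + cnj q) / 2"
  define t where "t = (p - cnj q) / (2 * \<i>)"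
  have pq: "cmod p < r / 2" "cmod q < r / 2"
    using w v by (simp_all add: p_def q_def dist_norm norm_minus_commute)
  have "s \<in> ball 0 (r / 2)" "t \<in> ball 0 (r / 2)"
    using pq norm_triangle_ineq[of p "cnj q"] norm_triangle_ineq4[of p "cnj q"]
    by (simp_all add: s_def t_def norm_divide norm_mult)
  moreover have "s + \<i> * t = p"
    by (simp add: s_def t_def field_simps)
  moreover have "cnj s + \<i> * cnj t = q"
    by (simp add: s_def t_def field_simps)
  ultimately have "cinner (f (a + p)) (f (a + q)) - cinner (g (a + p)) (g (a + q)) = 0"
    using zero[of s t] by (simp add: H_def add.assoc)
  then show ?thesis
    by (simp add: p_def q_def)
qed

section \<open>Sections of line bundles of eigenspaces\<close>

lemma eigenspace_iff: "x \<in> eigenspace T w \<longleftrightarrow> T x = w *\<^sub>C x"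
  by (simp add: eigenspace_def)

lemma eigenspace_dim_1:
  assumes "cdim (eigenspace T w) = 1"
  shows "\<exists>x\<in>eigenspace T w. x \<noteq> 0"
    and "x \<in> eigenspace T w \<Longrightarrow> x \<noteq> 0 \<Longrightarrow> y \<in> eigenspace T w \<Longrightarrow> \<exists>c. y = c *\<^sub>C x"
proof -
  obtain B where B: "B \<subseteq> eigenspace T w" "complex_vector.independent B"
      "eigenspace T w \<subseteq> cspan B" "card B = cdim (eigenspace T w)"
    by (rule complex_vector.basis_exists)
  then obtain b where b: "B = {b}"
    using assms card_1_singletonE by metis
  show "\<exists>x\<in>eigenspace T w. x \<noteq> 0"
    using B b by (intro bexI[of _ b]) auto
  assume "x \<in> eigenspace T w" "x \<noteq> 0" "y \<in> eigenspace T w"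
  then obtain a d where "x = a *\<^sub>C b" "y = d *\<^sub>C b"
    using B(3) unfolding b complex_vector.span_singleton by blast
  then have "y = (d / a) *\<^sub>C x"
    using \<open>x \<noteq> 0\<close> by (simp add: scaleC_scaleC)
  then show "\<exists>c. y = c *\<^sub>C x" ..
qed

lemma cowen_douglas_1D:
  assumes "cowen_douglas 1 \<Omega> T"
  shows "bounded_clinear T" "w \<in> \<Omega> \<Longrightarrow> cdim (eigenspace T w) = 1"
    "closure (cspan (\<Union>w\<in>\<Omega>. eigenspace T w)) = UNIV"
  using assms by (auto simp: cowen_douglas_def)

text \<open>One-dimensional fibres make any two nowhere vanishing sections proportional, and near
  \<open>z\<close> the factor is holomorphic, so the candidates in the definite description all
  agree.\<close>

lemma curvature_eq_section_curvature:
  assumes T: "cowen_douglas 1 \<Omega> T" and U: "open U" "z \<in> U" "U \<subseteq> \<Omega>"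
    and \<gamma>: "nonvanishing_section T U \<gamma>"
  shows "curvature \<Omega> T z = section_curvature \<gamma> z"
  unfolding curvature_def
proof (rule the_equality)
  show "\<exists>U' \<gamma>'. open U' \<and> z \<in> U' \<and> U' \<subseteq> \<Omega> \<and> nonvanishing_section T U' \<gamma>' \<and>
      section_curvature \<gamma> z = section_curvature \<gamma>' z"
    using U \<gamma> by blast
next
  fix k
  assume "\<exists>V \<delta>. open V \<and> z \<in> V \<and> V \<subseteq> \<Omega> \<and> nonvanishing_section T V \<delta> \<and> k = section_curvature \<delta> z"
  then obtain V \<delta> where V: "open V" "z \<in> V" "V \<subseteq> \<Omega>" and \<delta>: "nonvanishing_section T V \<delta>"
    and k: "k = section_curvature \<delta> z"
    by blast
  \<comment> \<open>Pairing with a fixed vector exhibits the proportionality factor as a quotient of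
    scalar holomorphic functions. With this choice the denominator at \<open>z\<close> is
    \<open>cinner e e\<close>, which is non-zero, so it stays non-zero nearby.\<close>
  define e where "e = \<gamma> z"
  have \<gamma>': "vholomorphic_on \<gamma> U" "\<And>w. w \<in> U \<Longrightarrow> \<gamma> w \<in> eigenspace T w" "\<And>w. w \<in> U \<Longrightarrow> \<gamma> w \<noteq> 0"
    and \<delta>': "vholomorphic_on \<delta> V" "\<And>w. w \<in> V \<Longrightarrow> \<delta> w \<in> eigenspace T w" "\<And>w. w \<in> V \<Longrightarrow> \<delta> w \<noteq> 0"
    using \<gamma> \<delta> by (auto simp: nonvanishing_section_def holomorphic_section_def)
  define W where "W = (U \<inter> V) \<inter> (\<lambda>w. cinner (\<gamma> w) e) -` (- {0})"
  have hol: "(\<lambda>w. cinner (\<gamma> w) e) holomorphic_on U \<inter> V" "(\<lambda>w. cinner (\<delta> w) e) holomorphic_on U \<inter> V"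
    using vholomorphic_on_cinner(1)[OF \<gamma>'(1) U(1)] vholomorphic_on_cinner(1)[OF \<delta>'(1) V(1)]
    by (auto intro: holomorphic_on_subset)
  have W: "open W"
    unfolding W_def using U(1) V(1) holomorphic_on_imp_continuous_on[OF hol(1)]
    by (intro continuous_open_preimage) auto
  have z: "z \<in> W"
    using U V \<gamma>'(3) by (simp add: W_def e_def)
  have WUV: "W \<subseteq> U" "W \<subseteq> V" "W \<subseteq> U \<inter> V"
    by (auto simp: W_def)
  define \<phi> where "\<phi> w = cinner (\<delta> w) e / cinner (\<gamma> w) e" for w
  have eq: "\<delta> w = \<phi> w *\<^sub>C \<gamma> w" if w: "w \<in> W" for w
  proof -
    have wUV: "w \<in> U" "w \<in> V" "w \<in> \<Omega>" "cinner (\<gamma> w) e \<noteq> 0"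
      using w U(3) by (auto simp: W_def)
    obtain c where "\<delta> w = c *\<^sub>C \<gamma> w"
      using eigenspace_dim_1(2)[OF cowen_douglas_1D(2)[OF T wUV(3)] \<gamma>'(2)[OF wUV(1)]
          \<gamma>'(3)[OF wUV(1)] \<delta>'(2)[OF wUV(2)]] by blast
    then show ?thesis
      using wUV(4) by (simp add: \<phi>_def cinner_scaleC_left)
  qed
  have "section_curvature \<delta> z = section_curvature \<gamma> z"
  proof (rule section_curvature_proportional[OF _ _ W z _ _ eq])
    show "\<phi> holomorphic_on W"
      unfolding \<phi>_def using WUV hol by (intro holomorphic_on_divide) (auto simp: W_def intro: holomorphic_on_subset)
    show "vholomorphic_on \<gamma> W"
      by (rule vholomorphic_on_subset[OF \<gamma>'(1) U(1) W WUV(1)])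
    show "\<gamma> w \<noteq> 0" if "w \<in> W" for w
      using that WUV \<gamma>' by blast
    show "\<phi> w \<noteq> 0" if "w \<in> W" for w
      using eq[OF that] that WUV(2) \<delta>'(3) by fastforce
  qed
  then show "k = section_curvature \<gamma> z"
    using k by simp
qed

lemma vholomorphic_eq_0_on_connected:
  assumes "vholomorphic_on f \<Omega>" "open \<Omega>" "connected \<Omega>"
    and "open D" "D \<noteq> {}" "D \<subseteq> \<Omega>" "\<And>w. w \<in> D \<Longrightarrow> cinner (f w) x = 0" "z \<in> \<Omega>"
  shows "cinner (f z) x = 0"
  by (rule analytic_continuation_open[where s = D and s' = \<Omega> and g = "\<lambda>_. 0"])
    (use assms vholomorphic_on_cinner(1)[OF assms(1,2)] in simp_all)

section \<open>Higher derivatives of eigensections and density of their values\<close>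

lemma vholomorphic_on_vderiv_funpow:
  fixes f :: "complex \<Rightarrow> 'a::{complex_inner, complete_space}"
  assumes "vholomorphic_on f U" "open U"
  shows "vholomorphic_on ((vderiv ^^ n) f) U"
  by (induction n) (simp_all add: assms vholomorphic_on_vderiv)

lemma higher_deriv_cinner:
  fixes f :: "complex \<Rightarrow> 'a::{complex_inner, complete_space}"
  assumes "vholomorphic_on f U" "open U" "z \<in> U"
  shows "(deriv ^^ n) (\<lambda>w. cinner (f w) x) z = cinner ((vderiv ^^ n) f z) x"
  using assms(3)
proof (induction n arbitrary: z)
  case (Suc n)
  note hol = vholomorphic_on_vderiv_funpow[OF assms(1,2), of n]
  have "deriv ((deriv ^^ n) (\<lambda>w. cinner (f w) x)) z = deriv (\<lambda>w. cinner ((vderiv ^^ n) f w) x) z"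
  proof (rule deriv_cong_ev)
    show "\<forall>\<^sub>F w in nhds z. (deriv ^^ n) (\<lambda>w. cinner (f w) x) w = cinner ((vderiv ^^ n) f w) x"
      using Suc assms(2) eventually_nhds by blast
  qed simp
  then show ?case
    using vholomorphic_on_cinner(2)[OF hol assms(2) Suc.prems] by simp
qed simp

text \<open>Leibniz rule for the \<open>n\<close>-th derivative of
  \<open>A (f w) = w *\<^sub>C f w\<close>. For \<open>n = 0\<close> the truncated
  \<open>n - 1\<close> is harmless, because its coefficient is 0.\<close>

lemma eigensection_higher_vderiv:
  fixes f :: "complex \<Rightarrow> 'a::{complex_inner, complete_space}"
  assumes A: "bounded_clinear A" and f: "vholomorphic_on f U" "open U"
    and eig: "\<And>w. w \<in> U \<Longrightarrow> A (f w) = w *\<^sub>C f w" and "z \<in> U"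
  shows "A ((vderiv ^^ n) f z) = z *\<^sub>C (vderiv ^^ n) f z + of_nat n *\<^sub>C (vderiv ^^ (n - 1)) f z"
  using assms(5)
proof (induction n arbitrary: z)
  case 0
  then show ?case by (simp add: eig)
next
  case (Suc n)
  let ?f = "\<lambda>n. (vderiv ^^ n) f"
  note hol = vholomorphic_on_vderiv_funpow[OF f]
  have d: "(?f n has_derivative (\<lambda>h. h *\<^sub>C ?f (Suc n) z)) (at z)" for n
    using has_derivative_vderiv[OF hol f(2) Suc.prems] by simp
  have "((\<lambda>w. w *\<^sub>C ?f n w + of_nat n *\<^sub>C ?f (n - 1) w) has_derivative
      (\<lambda>h. (z *\<^sub>C h *\<^sub>C ?f (Suc n) z + h *\<^sub>C ?f n z) + of_nat n *\<^sub>C h *\<^sub>C ?f (Suc (n - 1)) z)) (at z)"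
    by (intro has_derivative_add has_derivative_scaleC[OF has_derivative_ident d]
        bounded_linear.has_derivative[OF bounded_linear_scaleC_right d])
  then have "((\<lambda>w. A (?f n w)) has_derivative
      (\<lambda>h. (z *\<^sub>C h *\<^sub>C ?f (Suc n) z + h *\<^sub>C ?f n z) + of_nat n *\<^sub>C h *\<^sub>C ?f (Suc (n - 1)) z)) (at z)"
    by (rule has_derivative_transform_within_open[OF _ f(2) Suc.prems]) (simp add: Suc.IH)
  moreover have "((\<lambda>w. A (?f n w)) has_derivative (\<lambda>h. h *\<^sub>C A (?f (Suc n) z))) (at z)"
    using bounded_linear.has_derivative[OF bounded_clinearD(1)[OF A] d[of n]]
    by (simp only: bounded_clinearD(3)[OF A])
  ultimately have "1 *\<^sub>C A (?f (Suc n) z) =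
      (z *\<^sub>C 1 *\<^sub>C ?f (Suc n) z + 1 *\<^sub>C ?f n z) + of_nat n *\<^sub>C 1 *\<^sub>C ?f (Suc (n - 1)) z"
    using has_derivative_unique by (metis (no_types, lifting))
  moreover have "of_nat n *\<^sub>C ?f (Suc (n - 1)) z = of_nat n *\<^sub>C ?f n z"
    by (cases n) simp_all
  ultimately show ?case
    by (simp only: scaleC_one scaleC_add_left of_nat_Suc add.assoc diff_Suc_1)
qed

text \<open>At a zero \<open>w\<close> of \<open>f\<close> the first non-vanishing derivative of \<open>f\<close> is still an eigenvector for \<open>w\<close>.\<close>

theorem eigensection_dense:
  fixes f :: "complex \<Rightarrow> 'a::separable_chilbert"
  assumes \<Omega>: "open \<Omega>" "connected \<Omega>" and A: "cowen_douglas 1 \<Omega> A"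
    and f: "vholomorphic_on f \<Omega>" "\<And>w. w \<in> \<Omega> \<Longrightarrow> f w \<in> eigenspace A w"
    and nz: "a \<in> \<Omega>" "f a \<noteq> 0" and D: "open D" "D \<noteq> {}" "D \<subseteq> \<Omega>"
  shows "closure (cspan (f ` D)) = UNIV"
proof (rule closure_cspan_eq_UNIV)
  fix x assume "\<And>v. v \<in> f ` D \<Longrightarrow> cinner v x = 0"
  then have zero: "cinner (f w) x = 0" if "w \<in> \<Omega>" for w
    using vholomorphic_eq_0_on_connected[OF f(1) \<Omega> D _ that] by blast
  have zero': "cinner ((vderiv ^^ n) f w) x = 0" if w: "w \<in> \<Omega>" for n w
  proof -
    have "(deriv ^^ n) (\<lambda>w. cinner (f w) x) w = (deriv ^^ n) (\<lambda>w. 0) w"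
      using zero \<Omega>(1) w by (intro higher_deriv_cong_ev refl) (auto simp: eventually_nhds)
    then show ?thesis
      by (simp add: higher_deriv_cinner[OF f(1) \<Omega>(1) w])
  qed
  have orth: "cinner v x = 0" if w: "w \<in> \<Omega>" and v: "v \<in> eigenspace A w" for v w
  proof -
    \<comment> \<open>If every derivative vanished at \<open>w\<close>, the scalar function pairing
      \<open>f\<close> with \<open>f a\<close> would vanish on all of \<Omega>, contradicting its
      value at \<open>a\<close>.\<close>
    have ex: "\<exists>n. (vderiv ^^ n) f w \<noteq> 0"
    proof (rule ccontr)
      assume "\<not> ?thesis"
      then have "(deriv ^^ n) (\<lambda>w. cinner (f w) (f a)) w = 0" for n
        by (simp add: higher_deriv_cinner[OF f(1) \<Omega>(1) w])
      then have "cinner (f a) (f a) = 0"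
        by (rule holomorphic_fun_eq_0_on_connected[OF vholomorphic_on_cinner(1)[OF f(1) \<Omega>(1)] \<Omega> _ w nz(1)])
      then show False
        using nz(2) by simp
    qed
    define n where "n = (LEAST n. (vderiv ^^ n) f w \<noteq> 0)"
    have n: "(vderiv ^^ n) f w \<noteq> 0"
      unfolding n_def by (rule LeastI_ex[OF ex])
    \<comment> \<open>The correction term in the eigenvector equation: its coefficient is 0 for
      \<open>n = 0\<close>, and otherwise its vector is 0 by minimality of \<open>n\<close>.\<close>
    have "of_nat n *\<^sub>C (vderiv ^^ (n - 1)) f w = 0"
    proof (cases n)
      case (Suc m)
      then have "(vderiv ^^ m) f w = 0"
        using not_less_Least[of m "\<lambda>n. (vderiv ^^ n) f w \<noteq> 0"] by (simp add: n_def)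
      then show ?thesis
        by (simp add: Suc)
    qed simp
    then have "(vderiv ^^ n) f w \<in> eigenspace A w"
      using eigensection_higher_vderiv[OF cowen_douglas_1D(1)[OF A] f(1) \<Omega>(1) _ w, of n] f(2)
      by (simp add: eigenspace_iff)
    then obtain c where "v = c *\<^sub>C (vderiv ^^ n) f w"
      using eigenspace_dim_1(2)[OF cowen_douglas_1D(2)[OF A w] _ n v] by blast
    then show ?thesis
      by (simp add: cinner_scaleC_left zero'[OF w])
  qed
  show "x = 0"
    using orthogonal_dense_span[OF cowen_douglas_1D(3)[OF A]] orth by blast
qed

section \<open>Unitary operators and the invariance of curvature\<close>

lemma unitaryD:
  assumes "unitary U"
  shows "bounded_clinear U" "surj U" "cinner (U x) (U y) = cinner x y" "norm (U x) = norm x"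
proof -
  show 1: "bounded_clinear U" "surj U" "cinner (U x) (U y) = cinner x y" for x y
    using assms by (simp_all add: unitary_def)
  have "complex_of_real ((norm (U x))\<^sup>2) = complex_of_real ((norm x)\<^sup>2)"
    using 1(3)[of x x] unfolding cinner_self .
  then show "norm (U x) = norm x"
    unfolding of_real_eq_iff by simp
qed

lemma unitary_intro:
  assumes "bounded_clinear U" "surj U" "\<And>x y. cinner (U x) (U y) = cinner x y"
  shows "unitary U"
  using assms by (simp add: unitary_def)

lemma unitary_inv:
  assumes "unitary U"
  shows "unitary (inv U)" "inv U (U x) = x" "U (inv U y) = y"
proof -
  note U = unitaryD[OF assms]
  note l = bounded_clinearD[OF U(1)]
  have "x = y" if "U x = U y" for x y
  proof -
    have "norm (U (x - y)) = 0"
      using that by (simp add: l)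
    then show ?thesis
      by (simp add: U(4))
  qed
  then have inj: "inj U"
    by (rule injI)
  show iU: "inv U (U x) = x" for x
    using inj by simp
  show Ui: "U (inv U y) = y" for y
    using U(2) by (simp add: surj_f_inv_f)
  have add: "inv U (x + y) = inv U x + inv U y" for x y
    by (metis Ui iU l(2))
  have scale: "inv U (c *\<^sub>C x) = c *\<^sub>C inv U x" for c x
    by (metis Ui iU l(3))
  have norm: "norm (inv U x) = norm x" for x
    by (metis Ui U(4))
  show "unitary (inv U)"
  proof (rule unitary_intro)
    show "bounded_clinear (inv U)"
      unfolding bounded_clinear_def
      by (intro conjI allI bounded_linear_intro[of _ 1]) (simp_all add: add scale norm scaleR_scaleC)
    show "surj (inv U)"
      using inj by (rule inj_imp_surj_inv)
    show "cinner (inv U x) (inv U y) = cinner x y" for x y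
      using U(3)[of "inv U x" "inv U y"] by (simp only: Ui)
  qed
qed

lemma nonvanishing_section_unitary:
  assumes \<gamma>: "nonvanishing_section T V \<gamma>" and V: "open V"
    and A: "unitary A" and int: "\<And>x. A (T x) = T' (A x)"
  shows "nonvanishing_section T' V (\<lambda>w. A (\<gamma> w))"
    and "section_curvature (\<lambda>w. A (\<gamma> w)) = section_curvature \<gamma>"
proof -
  note u = unitaryD[OF A]
  have \<gamma>: "vholomorphic_on \<gamma> V" "\<And>w. w \<in> V \<Longrightarrow> T (\<gamma> w) = w *\<^sub>C \<gamma> w" "\<And>w. w \<in> V \<Longrightarrow> \<gamma> w \<noteq> 0"
    using \<gamma> by (auto simp: nonvanishing_section_def holomorphic_section_def eigenspace_iff)
  have "A (\<gamma> w) \<noteq> 0" if "w \<in> V" for w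
    using \<gamma>(3)[OF that] u(4)[of "\<gamma> w"] by auto
  moreover have "T' (A (\<gamma> w)) = w *\<^sub>C A (\<gamma> w)" if "w \<in> V" for w
    using \<gamma>(2)[OF that] by (simp add: bounded_clinearD(3)[OF u(1)] flip: int)
  ultimately show "nonvanishing_section T' V (\<lambda>w. A (\<gamma> w))"
    using bounded_clinear_vholomorphic_on(1)[OF u(1) \<gamma>(1) V]
    by (simp add: nonvanishing_section_def holomorphic_section_def eigenspace_iff)
  show "section_curvature (\<lambda>w. A (\<gamma> w)) = section_curvature \<gamma>"
    by (simp add: section_curvature_def u(4) fun_eq_iff)
qed

text \<open>\<open>A\<close> and its inverse carry nowhere vanishing sections to each other and
  preserve norms, so the two definite descriptions range over the same candidates; the equality
  therefore holds at every \<open>z\<close>.\<close>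

lemma curvature_unitary_invariant:
  assumes A: "unitary A" and int: "A \<circ> T = T' \<circ> A"
  shows "curvature \<Omega> T z = curvature \<Omega> T' z"
proof -
  have AT: "A (T x) = T' (A x)" for x
    using int by (simp add: fun_eq_iff)
  have AT': "inv A (T' y) = T (inv A y)" for y
    by (metis AT unitary_inv(2,3)[OF A])
  have "(\<exists>U \<gamma>. open U \<and> z \<in> U \<and> U \<subseteq> \<Omega> \<and> nonvanishing_section T U \<gamma> \<and> k = section_curvature \<gamma> z) \<longleftrightarrow>
      (\<exists>U \<gamma>. open U \<and> z \<in> U \<and> U \<subseteq> \<Omega> \<and> nonvanishing_section T' U \<gamma> \<and> k = section_curvature \<gamma> z)" for k
    using nonvanishing_section_unitary[where T = T and T' = T' and A = A, OF _ _ A AT]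
      nonvanishing_section_unitary[where T = T' and T' = T and A = "inv A", OF _ _ unitary_inv(1)[OF A] AT']
    by metis
  then show ?thesis
    unfolding curvature_def by simp
qed

section \<open>Intertwiners of upper triangular operators\<close>

lemma norm_funpow_le:
  fixes A :: "'a::real_normed_vector \<Rightarrow> 'a"
  assumes "\<And>x. norm (A x) \<le> K * norm x" "0 \<le> K"
  shows "norm ((A ^^ n) x) \<le> K ^ n * norm x"
proof (induction n)
  case (Suc n)
  have "norm ((A ^^ Suc n) x) \<le> K * norm ((A ^^ n) x)"
    using assms(1) by simp
  also have "\<dots> \<le> K * (K ^ n * norm x)"
    by (rule mult_left_mono[OF Suc assms(2)])
  finally show ?case
    by (simp add: mult.assoc)
qed simp

text \<open>Comparing \<open>N\<^sup>2\<^sup>n Y\<^sup>n t = ((2n)! / 2\<^sup>n) f\<^sup>n t\<close> with the norm bound for the left-hand side shows that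
  \<open>\<bar>f\<bar>\<^sup>n n!\<close> grows at most geometrically.\<close>

lemma double_commutator_eigenvalue:
  fixes N Y W Z :: "'a::complex_inner \<Rightarrow> 'a"
  assumes lin: "bounded_clinear N" "bounded_clinear Y" "bounded_clinear W" "bounded_clinear Z"
    and NY: "\<And>x. N (Y x) = Y (N x) + W x"
    and NW: "\<And>x. N (W x) = W (N x) + Z x"
    and NZ: "\<And>x. N (Z x) = Z (N x)"
    and t: "N t = 0" "t \<noteq> 0" "Z t = f *\<^sub>C t"
  shows "f = 0"
proof (rule ccontr)
  assume "f \<noteq> 0"
  note l = bounded_clinearD[OF lin(1)] bounded_clinearD[OF lin(2)] bounded_clinearD[OF lin(3)]
    bounded_clinearD[OF lin(4)]
  have two: "v + v = (2::complex) *\<^sub>C v" for v :: 'a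
    by (metis one_add_one scaleC_add_left scaleC_one)
  \<comment> \<open>The binomial formula for moving a power of \<open>N\<close> past
    \<open>Y\<close> by iterated commutators. It stops at the second commutator \<open>Z\<close>,
    which commutes with \<open>N\<close>; the last coefficient is \<open>m + 2\<close> choose 2. The
    offset 2 avoids subtraction in the exponents.\<close>
  have comm: "(N ^^ (m + 2)) (Y x) = Y ((N ^^ (m + 2)) x) + of_nat (m + 2) *\<^sub>C W ((N ^^ (m + 1)) x) +
      (of_nat ((m + 1) * (m + 2)) / 2) *\<^sub>C Z ((N ^^ m) x)" for m x
  proof (induction m)
    case 0
    have "N (N (Y x)) = Y (N (N x)) + (W (N x) + W (N x)) + Z x"
      by (simp add: NY NW l(2) add.assoc)
    then show ?case
      using two[of "W (N x)"] by (simp add: numeral_2_eq_2 scaleC_one)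
  next
    case (Suc m)
    have "(N ^^ (Suc m + 2)) (Y x) = N ((N ^^ (m + 2)) (Y x))"
      by simp
    also have "\<dots> = Y ((N ^^ (Suc m + 2)) x) + W ((N ^^ (m + 2)) x)
        + of_nat (m + 2) *\<^sub>C (W ((N ^^ (m + 2)) x) + Z ((N ^^ (m + 1)) x))
        + (of_nat ((m + 1) * (m + 2)) / 2) *\<^sub>C Z ((N ^^ (m + 1)) x)"
      unfolding Suc by (simp add: l NY NW NZ)
    also have "\<dots> = Y ((N ^^ (Suc m + 2)) x) + (1 + of_nat (m + 2)) *\<^sub>C W ((N ^^ (m + 2)) x)
        + (of_nat (m + 2) + of_nat ((m + 1) * (m + 2)) / 2) *\<^sub>C Z ((N ^^ (m + 1)) x)"
      unfolding scaleC_add_left scaleC_add_right scaleC_one by (simp only: add_ac)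
    also have "1 + of_nat (m + 2) = (of_nat (Suc m + 2) :: complex)"
      by simp
    also have "of_nat (m + 2) + of_nat ((m + 1) * (m + 2)) / 2 = (of_nat ((Suc m + 1) * (Suc m + 2)) / 2 :: complex)"
      by (simp add: field_simps)
    finally show ?case
      by simp
  qed
  \<comment> \<open>This is \<open>(2n)! / 2\<^sup>n\<close> as a product of natural numbers: the
    factor \<open>(2k + 1) * (2k + 2) / 2\<close> gained at each step is an integer.\<close>
  define c where "c n = (\<Prod>k<n. (2 * k + 1) * (k + 1))" for n :: nat
  have key: "(N ^^ (2 * n)) ((Y ^^ n) t) = (of_nat (c n) * f ^ n) *\<^sub>C t" for n
  proof (induction n)
    case 0
    show ?case by (simp add: c_def scaleC_one)
  next
    case (Suc n)
    \<comment> \<open>By induction \<open>N\<^sup>2\<^sup>n\<close> sends \<open>Y\<^sup>n t\<close>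
      to a multiple of \<open>t\<close>, which \<open>N\<close> kills. Hence only the
      \<open>Z\<close> term of \<open>comm\<close> survives the next step.\<close>
    have z: "(N ^^ (2 * n + 1)) ((Y ^^ n) t) = 0"
      using Suc by (simp add: l t)
    have z2: "(N ^^ (2 * n + 2)) ((Y ^^ n) t) = 0"
      using z by (simp add: l)
    have "(N ^^ (2 * Suc n)) ((Y ^^ Suc n) t) = (N ^^ (2 * n + 2)) (Y ((Y ^^ n) t))"
      by simp
    also have "\<dots> = (of_nat ((2 * n + 1) * (2 * n + 2)) / 2) *\<^sub>C (of_nat (c n) * f ^ n) *\<^sub>C f *\<^sub>C t"
      unfolding comm z z2 Suc by (simp add: l t)
    also have "\<dots> = (of_nat (c (Suc n)) * f ^ Suc n) *\<^sub>C t"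
    proof -
      have "(of_nat ((2 * n + 1) * (2 * n + 2)) / 2 :: complex) = of_nat ((2 * n + 1) * (n + 1))"
        by (simp add: field_simps)
      moreover have "c (Suc n) = (2 * n + 1) * (n + 1) * c n"
        by (simp add: c_def mult.commute)
      ultimately show ?thesis
        unfolding scaleC_scaleC by (simp only: of_nat_mult power_Suc mult_ac)
    qed
    finally show ?case .
  qed
  have c: "fact n \<le> c n" for n
  proof (induction n)
    case (Suc n)
    have "Suc n * fact n \<le> ((2 * n + 1) * (n + 1)) * c n"
      by (intro mult_mono Suc) auto
    then show ?case
      by (simp add: c_def mult.commute)
  qed (simp add: c_def)
  obtain a where a: "a > 0" "\<And>x. norm (N x) \<le> norm x * a"
    using bounded_linear.pos_bounded[OF l(1)] by blast
  obtain b where b: "b > 0" "\<And>x. norm (Y x) \<le> norm x * b"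
    using bounded_linear.pos_bounded[OF bounded_clinearD(1)[OF lin(2)]] by blast
  have le: "fact n * cmod f ^ n \<le> (a\<^sup>2 * b) ^ n" for n
  proof -
    have "real (fact n) * cmod f ^ n * norm t \<le> real (c n) * cmod f ^ n * norm t"
      using c by (intro mult_right_mono) (simp_all only: of_nat_le_iff zero_le_power norm_ge_zero)
    also have "\<dots> = norm ((N ^^ (2 * n)) ((Y ^^ n) t))"
      unfolding key by (simp add: norm_mult norm_power)
    also have "\<dots> \<le> a ^ (2 * n) * norm ((Y ^^ n) t)"
      using a by (intro norm_funpow_le) (simp_all add: mult.commute)
    also have "\<dots> \<le> a ^ (2 * n) * (b ^ n * norm t)"
      using a b by (intro mult_left_mono norm_funpow_le) (simp_all add: mult.commute)
    finally show ?thesis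
      using t(2) by (simp add: power_mult power_mult_distrib)
  qed
  \<comment> \<open>These are the terms of the exponential series at
    \<open>a\<^sup>2 * b / cmod f\<close>; once one of them is below 1, \<open>le\<close>
    fails.\<close>
  have "(\<lambda>n. inverse (fact n) * (a\<^sup>2 * b / cmod f) ^ n) \<longlonglongrightarrow> 0"
    by (rule summable_LIMSEQ_zero[OF summable_exp])
  then have "eventually (\<lambda>n. inverse (fact n) * (a\<^sup>2 * b / cmod f) ^ n < 1) sequentially"
    by (rule order_tendstoD) simp
  then obtain n where "inverse (fact n) * (a\<^sup>2 * b / cmod f) ^ n < 1"
    by (auto simp: eventually_sequentially)
  then have "(a\<^sup>2 * b) ^ n < fact n * cmod f ^ n"
    using \<open>f \<noteq> 0\<close> by (simp add: power_divide field_simps)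
  with le[of n] show False
    by simp
qed

lemma bounded_clinear_entries:
  assumes "bounded_clinear A"
  shows "bounded_clinear (\<lambda>x. fst (A (x, 0)))" "bounded_clinear (\<lambda>x. snd (A (x, 0)))"
    "bounded_clinear (\<lambda>y. fst (A (0, y)))" "bounded_clinear (\<lambda>y. snd (A (0, y)))"
proof -
  note A1 = bounded_clinear_compose[OF assms bounded_clinear_Pair[OF bounded_clinear_ident bounded_clinear_zero]]
  note A2 = bounded_clinear_compose[OF assms bounded_clinear_Pair[OF bounded_clinear_zero bounded_clinear_ident]]
  show "bounded_clinear (\<lambda>x. fst (A (x, 0)))" "bounded_clinear (\<lambda>x. snd (A (x, 0)))"
    "bounded_clinear (\<lambda>y. fst (A (0, y)))" "bounded_clinear (\<lambda>y. snd (A (0, y)))"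
    using bounded_clinear_compose[OF bounded_clinear_fst A1] bounded_clinear_compose[OF bounded_clinear_snd A1]
      bounded_clinear_compose[OF bounded_clinear_fst A2] bounded_clinear_compose[OF bounded_clinear_snd A2]
    by simp_all
qed

text \<open>Write \<open>U10 (S t) = c *\<^sub>C t'\<close> and
  \<open>V10 (S' t') = e *\<^sub>C t\<close>. The double commutator \<open>Z\<close> has eigenvalue
  \<open>2 * (c * e)\<close> on \<open>S t\<close>, so this number is 0; but
  \<open>c \<noteq> 0\<close> would force \<open>e \<noteq> 0\<close> by invertibility of
  \<open>U\<close>.\<close>

lemma intertwiner_lower_left_eq_0:
  fixes T0 :: "'a::separable_chilbert \<Rightarrow> 'a" and T1 :: "'b::separable_chilbert \<Rightarrow> 'b"
    and T0' :: "'c::separable_chilbert \<Rightarrow> 'c" and T1' :: "'d::separable_chilbert \<Rightarrow> 'd"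
  assumes T: "bounded_clinear T0" "bounded_clinear S" "bounded_clinear T1" "\<And>y. T0 (S y) = S (T1 y)"
    and T': "bounded_clinear T0'" "bounded_clinear S'" "bounded_clinear T1'" "\<And>y. T0' (S' y) = S' (T1' y)"
    and U: "bounded_clinear U" and V: "bounded_clinear V"
    and VU: "\<And>p. V (U p) = p" and UV: "\<And>q. U (V q) = q"
    and UT: "\<And>p. U (upper_block T0 S T1 p) = upper_block T0' S' T1' (U p)"
    and dim: "cdim (eigenspace T0 w) = 1" "cdim (eigenspace T1 w) = 1" "cdim (eigenspace T1' w) = 1"
    and t: "t \<in> eigenspace T1 w" "S t \<noteq> 0" and t': "t' \<in> eigenspace T1' w" "S' t' \<noteq> 0"
  shows "snd (U (S t, 0)) = 0"
proof (rule ccontr)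
  note l = bounded_clinearD[OF T(1)] bounded_clinearD[OF T(2)] bounded_clinearD[OF T(3)]
    bounded_clinearD[OF T'(1)] bounded_clinearD[OF T'(2)] bounded_clinearD[OF T'(3)]
    bounded_clinearD[OF U] bounded_clinearD[OF V]
  have VT: "V (upper_block T0' S' T1' q) = upper_block T0 S T1 (V q)" for q
    using VU[of "upper_block T0 S T1 (V q)"] unfolding UT UV .
  define U00 where "U00 x = fst (U (x, 0))" for x
  define U10 where "U10 x = snd (U (x, 0))" for x
  define V00 where "V00 x = fst (V (x, 0))" for x
  define V10 where "V10 x = snd (V (x, 0))" for x
  have lin: "bounded_clinear U00" "bounded_clinear U10" "bounded_clinear V00" "bounded_clinear V10"
    unfolding U00_def U10_def V00_def V10_def by (rule bounded_clinear_entries[OF U] bounded_clinear_entries[OF V])+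
  note l' = bounded_clinearD[OF lin(1)] bounded_clinearD[OF lin(2)] bounded_clinearD[OF lin(3)]
    bounded_clinearD[OF lin(4)]
  have U': "U (x, 0) = (U00 x, U10 x)" and V': "V (y, 0) = (V00 y, V10 y)" for x y
    by (simp_all add: U00_def U10_def V00_def V10_def)
  have U00: "T0' (U00 x) = U00 (T0 x) - S' (U10 x)" and U10: "T1' (U10 x) = U10 (T0 x)" for x
    using UT[of "(x, 0)"] by (simp_all add: upper_block_def U' bounded_clinearD(4)[OF T(2)] bounded_clinearD(4)[OF T(3)])
  have V00: "T0 (V00 x) = V00 (T0' x) - S (V10 x)" and V10: "T1 (V10 x) = V10 (T0' x)" for x
    using VT[of "(x, 0)"] by (simp_all add: upper_block_def V' bounded_clinearD(4)[OF T'(2)] bounded_clinearD(4)[OF T'(3)])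
  \<comment> \<open>Subtracting \<open>w\<close> changes no commutator and makes \<open>N\<close>
    kill \<open>S t\<close>. Below, \<open>W\<close> is the commutator of \<open>N\<close> with
    \<open>Y\<close>, and \<open>Z\<close> that of \<open>N\<close> with \<open>W\<close>; the two
    summands of \<open>W\<close> contribute equally to \<open>Z\<close>, hence the 2.\<close>
  define N where "N x = T0 x - w *\<^sub>C x" for x
  define Y where "Y x = V00 (U00 x)" for x
  define W where "W x = (-1) *\<^sub>C (S (V10 (U00 x)) + V00 (S' (U10 x)))" for x
  define Z where "Z x = 2 *\<^sub>C S (V10 (S' (U10 x)))" for x
  assume nz: "snd (U (S t, 0)) \<noteq> 0"
  have neg1: "(-1) *\<^sub>C x = - x" for x :: 'a
    by (metis complex_vector.scale_minus_left scaleC_one)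
  have two: "2 *\<^sub>C x = x + x" for x :: 'a
    by (metis one_add_one scaleC_add_left scaleC_one)
  have two': "(2 * a) *\<^sub>C x = a *\<^sub>C x + a *\<^sub>C x" for a and x :: 'a
    by (metis mult_2 scaleC_add_left)
  have eig: "T0 (S t) = w *\<^sub>C S t" "T0' (S' t') = w *\<^sub>C S' t'"
    using t t' T T' l by (simp_all add: eigenspace_iff)
  have "U10 (S t) \<in> eigenspace T1' w"
    by (simp add: eigenspace_iff U10 eig l')
  moreover have "t' \<noteq> 0"
    using t' l by auto
  ultimately obtain c where c: "U10 (S t) = c *\<^sub>C t'"
    using eigenspace_dim_1(2)[OF dim(3) t'(1)] by blast
  have c0: "c \<noteq> 0"
    using nz c by (auto simp: U10_def)
  \<comment> \<open>Otherwise \<open>V00 (S' t')\<close> would lie in the one-dimensional eigenspace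
    spanned by \<open>S t\<close>. Applying \<open>U\<close> and comparing components then gives
    \<open>U10 (S t) = 0\<close> or \<open>S' t' = 0\<close>.\<close>
  have V10_nz: "V10 (S' t') \<noteq> 0"
  proof
    assume 0: "V10 (S' t') = 0"
    then have "V00 (S' t') \<in> eigenspace T0 w"
      by (simp add: eigenspace_iff V00 eig l l')
    then obtain d where d: "V00 (S' t') = d *\<^sub>C S t"
      using eigenspace_dim_1(2)[OF dim(1), of "S t"] t(2) eig(1) by (auto simp: eigenspace_iff)
    have "(S' t', 0) = U (d *\<^sub>C (S t, 0))"
      using UV[of "(S' t', 0)"] by (simp add: V' 0 d scaleC_prod_def)
    also have "\<dots> = (d *\<^sub>C U00 (S t), d *\<^sub>C U10 (S t))"
      by (simp add: l U') (simp add: scaleC_prod_def)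
    finally have "d = 0 \<or> U10 (S t) = 0" "S' t' = d *\<^sub>C U00 (S t)"
      by auto
    then show False
      using t'(2) nz by (auto simp: U10_def)
  qed
  have "V10 (S' t') \<in> eigenspace T1 w"
    by (simp add: eigenspace_iff V10 eig l')
  moreover have "t \<noteq> 0"
    using t l by auto
  ultimately obtain e where e: "V10 (S' t') = e *\<^sub>C t"
    using eigenspace_dim_1(2)[OF dim(2) t(1)] by blast
  have e0: "e \<noteq> 0"
    using V10_nz e by auto
  have "2 * (c * e) = 0"
  proof (rule double_commutator_eigenvalue)
    show "bounded_clinear N" "bounded_clinear Y" "bounded_clinear W" "bounded_clinear Z"
      unfolding N_def Y_def W_def Z_def
      by (intro bounded_clinear_minus_scaleC bounded_clinear_scaleC bounded_clinear_add T T' lin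
          bounded_clinear_compose[OF lin(1)] bounded_clinear_compose[OF lin(2)]
          bounded_clinear_compose[OF lin(3)] bounded_clinear_compose[OF lin(4)]
          bounded_clinear_compose[OF T(2)] bounded_clinear_compose[OF T'(2)])+
    show "N (Y x) = Y (N x) + W x" for x
      by (simp add: N_def Y_def W_def V00 U00 l l' neg1)
    show "N (W x) = W (N x) + Z x" for x
      by (simp add: N_def W_def Z_def V00 U00 V10 U10 T(4) T'(4) l l' neg1 two scaleC_add_right scaleC_diff_right)
    show "N (Z x) = Z (N x)" for x
      by (simp add: N_def Z_def V10 U10 T(4) T'(4) l l' two two' scaleC_add_right scaleC_diff_right)
    show "N (S t) = 0"
      by (simp add: N_def eig)
    show "Z (S t) = (2 * (c * e)) *\<^sub>C S t"
      by (simp add: Z_def c e l l' scaleC_scaleC)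
  qed fact
  then show False
    using c0 e0 by simp
qed

section \<open>Sections and intertwiners for the triangular decompositions\<close>

lemma FB2_decompositionD:
  assumes "FB2_decomposition \<Omega> T T0 S T1"
  shows "T = upper_block T0 S T1" "cowen_douglas 1 \<Omega> T0" "cowen_douglas 1 \<Omega> T1"
    "bounded_clinear S" "S \<noteq> (\<lambda>_. 0)" "T0 (S y) = S (T1 y)"
  using assms by (auto simp: FB2_decomposition_def fun_eq_iff)

lemma nonvanishing_sectionD:
  assumes "nonvanishing_section T U s"
  shows "vholomorphic_on s U" "w \<in> U \<Longrightarrow> s w \<in> eigenspace T w" "w \<in> U \<Longrightarrow> s w \<noteq> 0"
    "w \<in> U \<Longrightarrow> T (s w) = w *\<^sub>C s w"
  using assms by (auto simp: nonvanishing_section_def holomorphic_section_def eigenspace_iff)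

text \<open>The relation between \<open>T0\<close>, \<open>S\<close> and \<open>T1\<close> makes
  \<open>S (t w)\<close> a section for \<open>T0\<close>, possibly with zeros. It cannot vanish on a
  non-empty open set, since the values of \<open>t\<close> there are total and
  \<open>S \<noteq> 0\<close>; hence its values on such a set are total as well.\<close>

lemma FB2_section:
  assumes \<Omega>: "open \<Omega>" "connected \<Omega>" and T: "FB2_decomposition \<Omega> T T0 S T1"
    and t: "nonvanishing_section T1 \<Omega> t"
  shows "vholomorphic_on (\<lambda>w. S (t w)) \<Omega>"
    and "w \<in> \<Omega> \<Longrightarrow> S (t w) \<in> eigenspace T0 w"
    and "\<exists>w\<in>\<Omega>. S (t w) \<noteq> 0"
    and "open D \<Longrightarrow> D \<noteq> {} \<Longrightarrow> D \<subseteq> \<Omega> \<Longrightarrow> closure (cspan (t ` D)) = UNIV"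
    and "open D \<Longrightarrow> D \<noteq> {} \<Longrightarrow> D \<subseteq> \<Omega> \<Longrightarrow> closure (cspan ((\<lambda>w. S (t w)) ` D)) = UNIV"
    and "open D \<Longrightarrow> D \<noteq> {} \<Longrightarrow> D \<subseteq> \<Omega> \<Longrightarrow> \<exists>w\<in>D. S (t w) \<noteq> 0"
    and "open D \<Longrightarrow> D \<subseteq> \<Omega> \<Longrightarrow> open {w\<in>D. S (t w) \<noteq> 0}"
proof -
  note T = FB2_decompositionD[OF T] and t = nonvanishing_sectionD[OF t]
  note l = bounded_clinearD[OF T(4)]
  show hol: "vholomorphic_on (\<lambda>w. S (t w)) \<Omega>"
    by (rule bounded_clinear_vholomorphic_on(1)[OF T(4) t(1) \<Omega>(1)])
  show eig: "S (t w) \<in> eigenspace T0 w" if "w \<in> \<Omega>" for w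
    by (simp add: eigenspace_iff T(6) t(4)[OF that] l(3))
  show dense: "closure (cspan (t ` D)) = UNIV" if D: "open D" "D \<noteq> {}" "D \<subseteq> \<Omega>" for D
  proof -
    obtain a where "a \<in> \<Omega>"
      using D by blast
    then show ?thesis
      using eigensection_dense[OF \<Omega> T(3) t(1,2) _ t(3) D] by blast
  qed
  show nz: "\<exists>w\<in>D. S (t w) \<noteq> 0" if D: "open D" "D \<noteq> {}" "D \<subseteq> \<Omega>" for D
  proof (rule ccontr)
    assume "\<not> ?thesis"
    then have "S x = 0" for x
      using eq_on_dense_span[OF T(4) bounded_clinear_zero dense[OF D]] by blast
    then show False
      using T(5) by auto
  qed
  \<comment> \<open>Over the empty set the spanning condition would make the space trivial, and then
    \<open>S = 0\<close>.\<close>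
  have "\<Omega> \<noteq> {}"
  proof
    assume "\<Omega> = {}"
    then have "closure (cspan ({} :: 'b set)) = UNIV"
      using cowen_douglas_1D(3)[OF T(3)] by simp
    then have "S x = 0" for x
      using eq_on_dense_span[OF T(4) bounded_clinear_zero, of "{}"] by blast
    then show False
      using T(5) by auto
  qed
  then show nz\<Omega>: "\<exists>w\<in>\<Omega>. S (t w) \<noteq> 0"
    using nz[of \<Omega>] \<Omega>(1) by blast
  show "closure (cspan ((\<lambda>w. S (t w)) ` D)) = UNIV" if D: "open D" "D \<noteq> {}" "D \<subseteq> \<Omega>" for D
    using nz\<Omega> eigensection_dense[OF \<Omega> T(2) hol eig _ _ D] by blast
  show "open {w\<in>D. S (t w) \<noteq> 0}" if D: "open D" "D \<subseteq> \<Omega>" for D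
  proof -
    have "continuous_on D (\<lambda>w. S (t w))"
      using continuous_on_subset[OF vholomorphic_on_continuous_on[OF hol \<Omega>(1)] D(2)] .
    then have "open (D \<inter> (\<lambda>w. S (t w)) -` (- {0}))"
      using D(1) by (intro continuous_open_preimage) auto
    then show ?thesis
      by (simp add: vimage_def Int_def)
  qed
qed

text \<open>The pointwise result applies wherever \<open>S t\<close> and \<open>S' t'\<close> are
  both non-zero, and the vectors \<open>S (t w)\<close> over that open set are total. The roles of
  the two operators can be exchanged, so the lemma also covers the inverse.\<close>

lemma FB2_intertwiner_lower_left:
  assumes \<Omega>: "open \<Omega>" "connected \<Omega>"
    and T: "FB2_decomposition \<Omega> T T0 S T1" and T': "FB2_decomposition \<Omega> T' T0' S' T1'"
    and t: "nonvanishing_section T1 \<Omega> t" and t': "nonvanishing_section T1' \<Omega> t'"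
    and U: "bounded_clinear U" and V: "bounded_clinear V" and VU: "\<And>p. V (U p) = p"
    and UV: "\<And>q. U (V q) = q" and UT: "\<And>p. U (T p) = T' (U p)"
  shows "snd (U (x, 0)) = 0"
proof -
  note TD = FB2_decompositionD[OF T] and TD' = FB2_decompositionD[OF T']
  note c0 = cowen_douglas_1D[OF TD(2)] and c1 = cowen_douglas_1D[OF TD(3)]
  note c0' = cowen_douglas_1D[OF TD'(2)] and c1' = cowen_douglas_1D[OF TD'(3)]
  note F = FB2_section[OF \<Omega> T t] and F' = FB2_section[OF \<Omega> T' t']
  define D where "D = {w\<in>{w\<in>\<Omega>. S (t w) \<noteq> 0}. S' (t' w) \<noteq> 0}"
  have op: "open {w\<in>\<Omega>. S (t w) \<noteq> 0}"
    using F(7) \<Omega>(1) by blast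
  have "open D" "D \<noteq> {}"
    using F'(7)[OF op] F'(6)[OF op] F(3) by (auto simp: D_def)
  moreover have "D \<subseteq> \<Omega>"
    by (auto simp: D_def)
  ultimately have dense: "closure (cspan ((\<lambda>w. S (t w)) ` D)) = UNIV"
    by (rule F(5))
  have zero: "snd (U (S (t w), 0)) = 0" if "w \<in> D" for w
  proof (rule intertwiner_lower_left_eq_0[where w = w and t' = "t' w" and V = V])
    have w: "w \<in> \<Omega>"
      using that by (simp add: D_def)
    show "cdim (eigenspace T0 w) = 1" "cdim (eigenspace T1 w) = 1" "cdim (eigenspace T1' w) = 1"
      using w c0 c1 c1' by blast+
    show "t w \<in> eigenspace T1 w" "t' w \<in> eigenspace T1' w"
      using w nonvanishing_sectionD[OF t] nonvanishing_sectionD[OF t'] by blast+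
    show "S (t w) \<noteq> 0" "S' (t' w) \<noteq> 0"
      using that by (simp_all add: D_def)
    show "U (upper_block T0 S T1 p) = upper_block T0' S' T1' (U p)" for p
      using UT unfolding TD(1) TD'(1) .
  qed (rule TD TD' c0(1) c1(1) c0'(1) c1'(1) U V VU UV)+
  show ?thesis
  proof (rule eq_on_dense_span[OF bounded_clinear_entries(2)[OF U] bounded_clinear_zero dense])
    show "snd (U (v, 0)) = 0" if "v \<in> (\<lambda>w. S (t w)) ` D" for v
      using that zero by blast
  qed
qed

theorem FB2_unitary_diagonal:
  assumes \<Omega>: "open \<Omega>" "connected \<Omega>"
    and T: "FB2_decomposition \<Omega> T T0 S T1" and T': "FB2_decomposition \<Omega> T' T0' S' T1'"
    and t: "nonvanishing_section T1 \<Omega> t" and t': "nonvanishing_section T1' \<Omega> t'"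
    and U: "unitary U" and UT: "\<And>p. U (T p) = T' (U p)"
  obtains A B where "unitary A" "unitary B" "\<And>x. A (T0 x) = T0' (A x)"
    "\<And>y. B (T1 y) = T1' (B y)" "\<And>y. A (S y) = S' (B y)"
proof -
  note TD = FB2_decompositionD[OF T] and TD' = FB2_decompositionD[OF T']
  note u = unitaryD[OF U] and i = unitary_inv[OF U]
  note v = unitaryD[OF i(1)]
  have VT: "inv U (T' q) = T (inv U q)" for q
    by (metis UT i(2,3))
  have low: "snd (U (x, 0)) = 0" for x
    by (rule FB2_intertwiner_lower_left[OF \<Omega> T T' t t' u(1) v(1) i(2,3) UT])
  have low': "snd (inv U (x, 0)) = 0" for x
    by (rule FB2_intertwiner_lower_left[OF \<Omega> T' T t' t v(1) u(1) i(3,2) VT])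
  \<comment> \<open>This entry of \<open>U\<close> is adjoint to the lower left entry of
    \<open>inv U\<close>; pairing with \<open>?x\<close> itself makes it vanish through
    \<open>low'\<close>.\<close>
  have up: "fst (U (0, y)) = 0" for y
  proof -
    let ?x = "fst (U (0, y))"
    have "cinner (inv U (?x, 0)) (0, y) = cinner (U (inv U (?x, 0))) (U (0, y))"
      by (simp only: u(3))
    then have "cinner ?x ?x = 0"
      by (simp add: i(3) cinner_prod_def low')
    then show ?thesis
      by simp
  qed
  define A where "A x = fst (U (x, 0))" for x
  define B where "B y = snd (U (0, y))" for y
  have UAB: "U (x, y) = (A x, B y)" for x y
  proof -
    have "U (x, y) = U ((x, 0) + (0, y))"
      by simp
    also have "\<dots> = U (x, 0) + U (0, y)"
      by (rule bounded_clinearD(2)[OF u(1)])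
    finally show ?thesis
      by (simp add: prod_eq_iff A_def B_def low up)
  qed
  have lin: "bounded_clinear A" "bounded_clinear B"
    unfolding A_def B_def by (rule bounded_clinear_entries[OF u(1)])+
  have "\<exists>x y. q = (A x, B y)" for q
    using surjD[OF u(2), of q] by (auto simp: UAB)
  then have "\<exists>x. x' = A x" "\<exists>y. y' = B y" for x' y'
    by (metis fst_conv, metis snd_conv)
  then have "surj A" "surj B"
    unfolding surj_def by blast+
  moreover have "cinner (A x) (A x') = cinner x x'" "cinner (B y) (B y') = cinner y y'" for x x' y y'
    using u(3)[of "(x, 0)" "(x', 0)"] u(3)[of "(0, y)" "(0, y')"]
    by (simp_all add: UAB cinner_prod_def bounded_clinearD(4)[OF lin(1)] bounded_clinearD(4)[OF lin(2)])
  ultimately have "unitary A" "unitary B"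
    using lin by (simp_all add: unitary_def)
  moreover have entries: "A (T0 x + S y) = T0' (A x) + S' (B y)" "B (T1 y) = T1' (B y)" for x y
    using UT[of "(x, y)"] by (simp_all add: TD(1) TD'(1) upper_block_def UAB)
  moreover have "A (T0 x) = T0' (A x)" for x
    using entries(1)[of x 0] by (simp add: bounded_clinearD(4)[OF lin(2)]
        bounded_clinearD(4)[OF TD(4)] bounded_clinearD(4)[OF TD'(4)])
  moreover have "A (S y) = S' (B y)" for y
    using entries(1)[of 0 y]
    by (simp add: bounded_clinearD(4)[OF lin(1)] bounded_clinearD(4)[OF cowen_douglas_1D(1)[OF TD(2)]]
        bounded_clinearD(4)[OF cowen_douglas_1D(1)[OF TD'(2)]])
  ultimately show ?thesis
    using that by blast
qed

text \<open>The common factor \<psi> is what couples the two unitaries: \<open>B\<close> sends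
  \<open>t w\<close> to \<open>\<psi> w *\<^sub>C t' w\<close> and \<open>A\<close> sends
  \<open>S (t w)\<close> to the \<open>S'\<close>-image of that vector, so \<open>A S = S' B\<close>
  already holds on a total set.\<close>

lemma FB2_unitarily_equivalent_intro:
  assumes \<Omega>: "open \<Omega>" "connected \<Omega>"
    and T: "FB2_decomposition \<Omega> T T0 S T1" and T': "FB2_decomposition \<Omega> T' T0' S' T1'"
    and t: "nonvanishing_section T1 \<Omega> t" and t': "nonvanishing_section T1' \<Omega> t'"
    and r: "r > 0" "ball a r \<subseteq> \<Omega>"
    and \<psi>: "\<psi> holomorphic_on ball a r" "\<And>w. w \<in> ball a r \<Longrightarrow> \<psi> w \<noteq> 0"
    and norm_t: "\<And>w. w \<in> ball a r \<Longrightarrow> norm (t w) = cmod (\<psi> w) * norm (t' w)"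
    and norm_S: "\<And>w. w \<in> ball a r \<Longrightarrow> norm (S (t w)) = cmod (\<psi> w) * norm (S' (t' w))"
  shows "unitarily_equivalent T T'"
proof -
  note TD = FB2_decompositionD[OF T] and TD' = FB2_decompositionD[OF T']
  note tD = nonvanishing_sectionD[OF t] and tD' = nonvanishing_sectionD[OF t']
  note F = FB2_section[OF \<Omega> T t] and F' = FB2_section[OF \<Omega> T' t']
  note lin = cowen_douglas_1D(1)[OF TD(2)] cowen_douglas_1D(1)[OF TD(3)]
    cowen_douglas_1D(1)[OF TD'(2)] cowen_douglas_1D(1)[OF TD'(3)]
  define g where "g w = \<psi> w *\<^sub>C t' w" for w
  \<comment> \<open>Polarization of a norm identity on a disc is available on the disc of half the
    radius; totality survives the shrinking.\<close>
  let ?D = "ball a (r / 2)"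
  have D: "open ?D" "?D \<noteq> {}" "?D \<subseteq> \<Omega>" "?D \<subseteq> ball a r"
    using r by (auto simp: subset_iff)
  have Sg: "S' (g w) = \<psi> w *\<^sub>C S' (t' w)" for w
    by (simp add: g_def bounded_clinearD(3)[OF TD'(4)])
  have T1g: "T1' (g w) = w *\<^sub>C g w" if "w \<in> \<Omega>" for w
    by (simp add: g_def bounded_clinearD(3)[OF lin(4)] tD'(4)[OF that] scaleC_scaleC mult.commute)
  have hol: "vholomorphic_on t (ball a r)" "vholomorphic_on (\<lambda>w. S (t w)) (ball a r)"
    "vholomorphic_on t' (ball a r)" "vholomorphic_on (\<lambda>w. S' (t' w)) (ball a r)"
    using vholomorphic_on_subset[OF _ \<Omega>(1) open_ball r(2)] tD(1) tD'(1) F(1) F'(1) by blast+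
  have "vholomorphic_on g (ball a r)" "vholomorphic_on (\<lambda>w. S' (g w)) (ball a r)"
    unfolding Sg unfolding g_def
    by (rule vholomorphic_on_scaleC(1)[OF \<psi>(1) hol(3) open_ball]
        vholomorphic_on_scaleC(1)[OF \<psi>(1) hol(4) open_ball])+
  then have gram: "cinner (t w) (t v) = cinner (g w) (g v)"
    "cinner (S (t w)) (S (t v)) = cinner (S' (g w)) (S' (g v))" if "w \<in> ?D" "v \<in> ?D" for w v
    using cinner_eq_of_norm_eq[OF hol(1) _ _ that, of g]
      cinner_eq_of_norm_eq[OF hol(2) _ _ that, of "\<lambda>w. S' (g w)"]
    by (simp_all add: Sg norm_S) (simp add: g_def norm_t)
  \<comment> \<open>Rescaling each vector by the non-zero number \<open>\<psi> w\<close> leaves the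
    span unchanged.\<close>
  have dense_scale: "closure (cspan ((\<lambda>w. \<psi> w *\<^sub>C f w) ` ?D)) = UNIV"
    if "closure (cspan (f ` ?D)) = UNIV" for f :: "complex \<Rightarrow> 'x::complex_inner"
  proof -
    have "f w \<in> cspan ((\<lambda>w. \<psi> w *\<^sub>C f w) ` ?D)" if "w \<in> ?D" for w
    proof -
      have "\<psi> w \<noteq> 0"
        using that D(4) \<psi>(2) by blast
      then have "f w = inverse (\<psi> w) *\<^sub>C \<psi> w *\<^sub>C f w"
        by (simp add: scaleC_scaleC scaleC_one)
      moreover have "\<psi> w *\<^sub>C f w \<in> cspan ((\<lambda>w. \<psi> w *\<^sub>C f w) ` ?D)"
        using that by (intro complex_vector.span_base imageI)
      ultimately show ?thesis
        using complex_vector.span_scale by metis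
    qed
    then have "cspan (f ` ?D) \<subseteq> cspan ((\<lambda>w. \<psi> w *\<^sub>C f w) ` ?D)"
      by (intro complex_vector.span_minimal complex_vector.subspace_span) blast
    then have "UNIV \<subseteq> closure (cspan ((\<lambda>w. \<psi> w *\<^sub>C f w) ` ?D))"
      using closure_mono that by metis
    then show ?thesis
      by blast
  qed
  obtain B where B: "unitary B" "\<And>w. w \<in> ?D \<Longrightarrow> B (t w) = g w"
    using unitary_of_gram_eq[OF gram(1) F(4)[OF D(1-3)] dense_scale[OF F'(4)[OF D(1-3)], folded g_def]]
    by metis
  obtain A where A: "unitary A" "\<And>w. w \<in> ?D \<Longrightarrow> A (S (t w)) = S' (g w)"
    using unitary_of_gram_eq[OF gram(2) F(5)[OF D(1-3)] dense_scale[OF F'(5)[OF D(1-3)], folded Sg]]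
    by metis
  note Al = unitaryD[OF A(1)] and Bl = unitaryD[OF B(1)]
  have AT: "A (T0 x) = T0' (A x)" for x
  proof (rule eq_on_dense_span[OF _ _ F(5)[OF D(1-3)]])
    show "bounded_clinear (\<lambda>x. A (T0 x))" "bounded_clinear (\<lambda>x. T0' (A x))"
      by (rule bounded_clinear_compose[OF Al(1) lin(1)] bounded_clinear_compose[OF lin(3) Al(1)])+
    fix v assume "v \<in> (\<lambda>w. S (t w)) ` ?D"
    then obtain w where w: "w \<in> ?D" "v = S (t w)"
      by blast
    then have "w \<in> \<Omega>"
      using D by blast
    then show "A (T0 v) = T0' (A v)"
      using w by (simp add: A(2) TD(6) TD'(6) tD(4) T1g bounded_clinearD(3)[OF TD(4)]
          bounded_clinearD(3)[OF TD'(4)] bounded_clinearD(3)[OF Al(1)])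
  qed
  have BT: "B (T1 y) = T1' (B y)" for y
  proof (rule eq_on_dense_span[OF _ _ F(4)[OF D(1-3)]])
    show "bounded_clinear (\<lambda>x. B (T1 x))" "bounded_clinear (\<lambda>x. T1' (B x))"
      by (rule bounded_clinear_compose[OF Bl(1) lin(2)] bounded_clinear_compose[OF lin(4) Bl(1)])+
    fix v assume "v \<in> t ` ?D"
    then obtain w where w: "w \<in> ?D" "v = t w"
      by blast
    then have "w \<in> \<Omega>"
      using D by blast
    then show "B (T1 v) = T1' (B v)"
      using w by (simp add: B(2) tD(4) T1g bounded_clinearD(3)[OF Bl(1)])
  qed
  have AS: "A (S y) = S' (B y)" for y
  proof (rule eq_on_dense_span[OF _ _ F(4)[OF D(1-3)]])
    show "bounded_clinear (\<lambda>x. A (S x))" "bounded_clinear (\<lambda>x. S' (B x))"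
      by (rule bounded_clinear_compose[OF Al(1) TD(4)] bounded_clinear_compose[OF TD'(4) Bl(1)])+
    show "A (S v) = S' (B v)" if "v \<in> t ` ?D" for v
      using that by (auto simp: A(2) B(2))
  qed
  define U where "U = (\<lambda>(x, y). (A x, B y))"
  have "unitary U"
  proof (rule unitary_intro)
    show "bounded_clinear U"
      unfolding U_def case_prod_beta
      by (rule bounded_clinear_Pair[OF bounded_clinear_compose[OF Al(1) bounded_clinear_fst]
            bounded_clinear_compose[OF Bl(1) bounded_clinear_snd]])
    show "surj U"
      unfolding surj_def
    proof
      fix q
      show "\<exists>p. q = U p"
        by (rule exI[of _ "(inv A (fst q), inv B (snd q))"])
           (simp add: U_def unitary_inv(3)[OF A(1)] unitary_inv(3)[OF B(1)])
    qed
    show "cinner (U p) (U q) = cinner p q" for p q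
      by (simp add: U_def case_prod_beta cinner_prod_def Al(3) Bl(3))
  qed
  moreover have "U \<circ> T = T' \<circ> U"
    by (simp add: fun_eq_iff U_def TD(1) TD'(1) upper_block_def bounded_clinearD(2)[OF Al(1)] AT BT AS)
  ultimately show ?thesis
    unfolding unitarily_equivalent_def by blast
qed

text \<open>Equal ratios let a norm identity with factor \<open>c\<close> pass between the sections
  and their images, in either direction; this is why the curvature of either diagonal entry
  suffices.\<close>

lemma ratio_eq_iff:
  assumes "x > 0" "y > 0" "u > 0" "v > (0::real)" "c > 0" "u\<^sup>2 / x\<^sup>2 = v\<^sup>2 / y\<^sup>2"
  shows "u = c * v \<longleftrightarrow> x = c * y"
proof -
  have "(u / x)\<^sup>2 = (v / y)\<^sup>2"
    using assms(6) by (simp add: power_divide)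
  then have "u / x = v / y"
    using assms by (subst (asm) power2_eq_iff_nonneg) auto
  then have "u * y = v * x"
    using assms by (simp add: field_simps)
  then have "v * (x - c * y) = y * (u - c * v)"
    by (simp add: algebra_simps)
  then show ?thesis
    using assms by (metis diff_self eq_iff_diff_eq_0 less_irrefl mult_eq_0_iff)
qed

lemma FB2_unitarily_equivalent_of_curvature:
  assumes \<Omega>: "open \<Omega>" "connected \<Omega>"
    and T: "FB2_decomposition \<Omega> T T0 S T1" and T': "FB2_decomposition \<Omega> T' T0' S' T1'"
    and t: "nonvanishing_section T1 \<Omega> t" and t': "nonvanishing_section T1' \<Omega> t'"
    and curv: "(\<forall>w\<in>\<Omega>. curvature \<Omega> T0 w = curvature \<Omega> T0' w) \<or> (\<forall>w\<in>\<Omega>. curvature \<Omega> T1 w = curvature \<Omega> T1' w)"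
    and ratio: "\<forall>w\<in>\<Omega>. (norm (S (t w)))\<^sup>2 / (norm (t w))\<^sup>2 = (norm (S' (t' w)))\<^sup>2 / (norm (t' w))\<^sup>2"
  shows "unitarily_equivalent T T'"
proof -
  note TD = FB2_decompositionD[OF T] and TD' = FB2_decompositionD[OF T']
  note tD = nonvanishing_sectionD[OF t] and tD' = nonvanishing_sectionD[OF t']
  note F = FB2_section[OF \<Omega> T t] and F' = FB2_section[OF \<Omega> T' t']
  \<comment> \<open>On a disc avoiding the zeros of \<open>S t\<close>, the ratio condition also
    makes \<open>S' t'\<close> non-zero. Both images are then nowhere vanishing sections that
    compute the curvatures of \<open>T0\<close> and \<open>T0'\<close>.\<close>
  obtain a where "a \<in> {w\<in>\<Omega>. S (t w) \<noteq> 0}"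
    using F(3) by blast
  then obtain r where r: "r > 0" "ball a r \<subseteq> {w\<in>\<Omega>. S (t w) \<noteq> 0}"
    using F(7)[OF \<Omega>(1) order_refl] open_contains_ball by blast
  then have sub: "ball a r \<subseteq> \<Omega>"
    by blast
  have nz: "t w \<noteq> 0" "t' w \<noteq> 0" "S (t w) \<noteq> 0" "S' (t' w) \<noteq> 0" if w: "w \<in> ball a r" for w
  proof -
    have w\<Omega>: "w \<in> \<Omega>" and S: "S (t w) \<noteq> 0"
      using w r(2) by blast+
    show t: "t w \<noteq> 0" and t': "t' w \<noteq> 0"
      using tD(3) tD'(3) w\<Omega> by blast+
    show "S (t w) \<noteq> 0"
      by fact
    have "(norm (S (t w)))\<^sup>2 / (norm (t w))\<^sup>2 \<noteq> 0"
      using S t by simp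
    then show "S' (t' w) \<noteq> 0"
      using bspec[OF ratio w\<Omega>] by auto
  qed
  have sec: "nonvanishing_section T1 (ball a r) t" "nonvanishing_section T0 (ball a r) (\<lambda>w. S (t w))"
    "nonvanishing_section T1' (ball a r) t'" "nonvanishing_section T0' (ball a r) (\<lambda>w. S' (t' w))"
    using sub nz tD(2) tD'(2) F(2) F'(2) vholomorphic_on_subset[OF _ \<Omega>(1) open_ball sub] tD(1) tD'(1) F(1) F'(1)
    by (auto simp: nonvanishing_section_def holomorphic_section_def)
  note hol = nonvanishing_sectionD(1)[OF sec(1)] nonvanishing_sectionD(1)[OF sec(2)]
    nonvanishing_sectionD(1)[OF sec(3)] nonvanishing_sectionD(1)[OF sec(4)]
  have "\<exists>\<psi>. \<psi> holomorphic_on ball a r \<and> (\<forall>w\<in>ball a r. \<psi> w \<noteq> 0) \<and>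
      ((\<forall>w\<in>ball a r. norm (S (t w)) = cmod (\<psi> w) * norm (S' (t' w))) \<or>
       (\<forall>w\<in>ball a r. norm (t w) = cmod (\<psi> w) * norm (t' w)))"
    using curv
  proof
    assume K: "\<forall>w\<in>\<Omega>. curvature \<Omega> T0 w = curvature \<Omega> T0' w"
    have "section_curvature (\<lambda>w. S (t w)) w = section_curvature (\<lambda>w. S' (t' w)) w" if "w \<in> ball a r" for w
      using K that sub curvature_eq_section_curvature[OF TD(2) open_ball that sub sec(2)]
        curvature_eq_section_curvature[OF TD'(2) open_ball that sub sec(4)] by auto
    from equal_section_curvature[OF hol(2) nz(3) hol(4) nz(4) this] show ?thesis
      by metis
  next
    assume K: "\<forall>w\<in>\<Omega>. curvature \<Omega> T1 w = curvature \<Omega> T1' w"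
    have "section_curvature t w = section_curvature t' w" if "w \<in> ball a r" for w
      using K that sub curvature_eq_section_curvature[OF TD(3) open_ball that sub sec(1)]
        curvature_eq_section_curvature[OF TD'(3) open_ball that sub sec(3)] by auto
    from equal_section_curvature[OF hol(1) nz(1) hol(3) nz(2) this] show ?thesis
      by metis
  qed
  then obtain \<psi> where \<psi>: "\<psi> holomorphic_on ball a r" "\<And>w. w \<in> ball a r \<Longrightarrow> \<psi> w \<noteq> 0"
    and norms: "(\<forall>w\<in>ball a r. norm (S (t w)) = cmod (\<psi> w) * norm (S' (t' w))) \<or>
       (\<forall>w\<in>ball a r. norm (t w) = cmod (\<psi> w) * norm (t' w))"
    by blast
  have "norm (S (t w)) = cmod (\<psi> w) * norm (S' (t' w)) \<longleftrightarrow> norm (t w) = cmod (\<psi> w) * norm (t' w)"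
    if w: "w \<in> ball a r" for w
    using nz[OF w] \<psi>(2)[OF w] bspec[OF ratio subsetD[OF sub w]] by (intro ratio_eq_iff) simp_all
  with norms have "norm (S (t w)) = cmod (\<psi> w) * norm (S' (t' w))" "norm (t w) = cmod (\<psi> w) * norm (t' w)"
    if "w \<in> ball a r" for w
    using that by blast+
  then show ?thesis
    using FB2_unitarily_equivalent_intro[OF \<Omega> T T' t t' r(1) sub \<psi>] by blast
qed

text \<open>At each \<open>w\<close> the diagonal unitaries send \<open>t w\<close> to
  \<open>c *\<^sub>C t' w\<close> and \<open>S (t w)\<close> to \<open>c *\<^sub>C S' (t' w)\<close>
  with the same scalar \<open>c\<close>, whose modulus cancels in the ratio.\<close>

lemma FB2_invariants_of_unitarily_equivalent:
  assumes \<Omega>: "open \<Omega>" "connected \<Omega>"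
    and T: "FB2_decomposition \<Omega> T T0 S T1" and T': "FB2_decomposition \<Omega> T' T0' S' T1'"
    and t: "nonvanishing_section T1 \<Omega> t" and t': "nonvanishing_section T1' \<Omega> t'"
    and equiv: "unitarily_equivalent T T'"
  shows "curvature \<Omega> T0 w = curvature \<Omega> T0' w" "curvature \<Omega> T1 w = curvature \<Omega> T1' w"
    and "w \<in> \<Omega> \<Longrightarrow> (norm (S (t w)))\<^sup>2 / (norm (t w))\<^sup>2 = (norm (S' (t' w)))\<^sup>2 / (norm (t' w))\<^sup>2"
proof -
  note tD = nonvanishing_sectionD[OF t] and tD' = nonvanishing_sectionD[OF t']
  note TD' = FB2_decompositionD[OF T']
  obtain U where "unitary U" "\<And>p. U (T p) = T' (U p)"
    using equiv by (auto simp: unitarily_equivalent_def fun_eq_iff)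
  then obtain A B where AB: "unitary A" "unitary B" "\<And>x. A (T0 x) = T0' (A x)"
    "\<And>y. B (T1 y) = T1' (B y)" "\<And>y. A (S y) = S' (B y)"
    using FB2_unitary_diagonal[OF \<Omega> T T' t t'] by metis
  show "curvature \<Omega> T0 w = curvature \<Omega> T0' w" "curvature \<Omega> T1 w = curvature \<Omega> T1' w"
    using curvature_unitary_invariant[OF AB(1), of T0 T0'] curvature_unitary_invariant[OF AB(2), of T1 T1']
      AB(3,4) by (simp_all add: fun_eq_iff)
  assume w: "w \<in> \<Omega>"
  have "T1' (B (t w)) = w *\<^sub>C B (t w)"
    by (simp add: AB(4)[symmetric] tD(4)[OF w] bounded_clinearD(3)[OF unitaryD(1)[OF AB(2)]])
  then have "B (t w) \<in> eigenspace T1' w"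
    by (simp add: eigenspace_iff)
  then obtain c where c: "B (t w) = c *\<^sub>C t' w"
    using eigenspace_dim_1(2)[OF cowen_douglas_1D(2)[OF TD'(3) w] tD'(2)[OF w] tD'(3)[OF w]] by blast
  have 1: "norm (t w) = cmod c * norm (t' w)"
    using unitaryD(4)[OF AB(2), of "t w"] c by simp
  have 2: "norm (S (t w)) = cmod c * norm (S' (t' w))"
    using unitaryD(4)[OF AB(1), of "S (t w)"] by (simp add: AB(5) c bounded_clinearD(3)[OF TD'(4)])
  have "cmod c \<noteq> 0"
    using 1 tD(3)[OF w] by auto
  then show "(norm (S (t w)))\<^sup>2 / (norm (t w))\<^sup>2 = (norm (S' (t' w)))\<^sup>2 / (norm (t' w))\<^sup>2"
    unfolding 1 2 power_mult_distrib by simp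
qed

theorem theorem1:
  fixes \<Omega> :: "complex set"
    and T :: "'a::separable_chilbert \<times> 'b::separable_chilbert \<Rightarrow> 'a \<times> 'b"
    and T\<^sub>0 :: "'a \<Rightarrow> 'a" and S :: "'b \<Rightarrow> 'a" and T\<^sub>1 :: "'b \<Rightarrow> 'b"
    and T' :: "'c::separable_chilbert \<times> 'd::separable_chilbert \<Rightarrow> 'c \<times> 'd"
    and T\<^sub>0' :: "'c \<Rightarrow> 'c" and S' :: "'d \<Rightarrow> 'c" and T\<^sub>1' :: "'d \<Rightarrow> 'd"
    and t\<^sub>1 :: "complex \<Rightarrow> 'b" and t\<^sub>1' :: "complex \<Rightarrow> 'd"
  assumes "open \<Omega>" and "connected \<Omega>"
    and "FB2_decomposition \<Omega> T T\<^sub>0 S T\<^sub>1"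
    and "FB2_decomposition \<Omega> T' T\<^sub>0' S' T\<^sub>1'"
    and "nonvanishing_section T\<^sub>1 \<Omega> t\<^sub>1"
    and "nonvanishing_section T\<^sub>1' \<Omega> t\<^sub>1'"
  shows "(unitarily_equivalent T T' \<longleftrightarrow>
            (\<forall>w\<in>\<Omega>. curvature \<Omega> T\<^sub>0 w = curvature \<Omega> T\<^sub>0' w) \<and>
            (\<forall>w\<in>\<Omega>. (norm (S (t\<^sub>1 w)))\<^sup>2 / (norm (t\<^sub>1 w))\<^sup>2 =
                     (norm (S' (t\<^sub>1' w)))\<^sup>2 / (norm (t\<^sub>1' w))\<^sup>2)) \<and>
         (unitarily_equivalent T T' \<longleftrightarrow>
            (\<forall>w\<in>\<Omega>. curvature \<Omega> T\<^sub>1 w = curvature \<Omega> T\<^sub>1' w) \<and>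
            (\<forall>w\<in>\<Omega>. (norm (S (t\<^sub>1 w)))\<^sup>2 / (norm (t\<^sub>1 w))\<^sup>2 =
                     (norm (S' (t\<^sub>1' w)))\<^sup>2 / (norm (t\<^sub>1' w))\<^sup>2))"
  using FB2_unitarily_equivalent_of_curvature[OF assms] FB2_invariants_of_unitarily_equivalent[OF assms]
  by blast

end
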